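(* For each integer $k>0$, there are (up to isomorphism) only finitely many connected integer-weighted bipartite graphs with maximum degree at most $k$ that admit local uniform mixing at some vertex relative to the adjacency matrix $A$.
   Context: Graphs are finite, simple and undirected, with positive edge weights; integer-weighted means all edge weights are (positive) integers. The degree of a vertex is the sum of the weights of the edges incident to it. $A$ is the weighted adjacency matrix and $U(t)=e^{\mathrm{i}tA}$. For a graph on $n$ vertices, local uniform mixing occurs at a vertex $u$ relative to $A$ if there is a time $\tau>0$ such that every entry of the $u$th column of $U(\tau)$ has modulus $1/\sqrt{n}$. *)

theory Defs
  imports Complex_Main
begin

section \<open>Weighted graphs\<close>

record 'a wgraph =
  verts :: "'a set"
  weight :: "'a \<Rightarrow> 'a \<Rightarrow> real"

text \<open>Two vertices are adjacent iff the weight of the pair is nonzero, so \<open>weight G\<close> is both the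
  edge set and the weight function, and also the weighted adjacency matrix of \<open>G\<close>.\<close>

definition wgraph :: "'a wgraph \<Rightarrow> bool" where
  "wgraph G \<longleftrightarrow>
     finite (verts G) \<and>
     (\<forall>u v. weight G u v \<ge> 0) \<and>
     (\<forall>u v. weight G u v = weight G v u) \<and>
     (\<forall>u. weight G u u = 0) \<and>
     (\<forall>u v. weight G u v \<noteq> 0 \<longrightarrow> u \<in> verts G \<and> v \<in> verts G)"

definition edge_rel :: "'a wgraph \<Rightarrow> ('a \<times> 'a) set" where
  "edge_rel G = {(u, v). u \<in> verts G \<and> v \<in> verts G \<and> weight G u v > 0}"

definition integer_weighted :: "'a wgraph \<Rightarrow> bool" where
  "integer_weighted G \<longleftrightarrow> (\<forall>(u, v) \<in> edge_rel G. weight G u v \<in> \<int>)"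

definition connected_wgraph :: "'a wgraph \<Rightarrow> bool" where
  "connected_wgraph G \<longleftrightarrow>
     verts G \<noteq> {} \<and> (\<forall>u\<in>verts G. \<forall>v\<in>verts G. (u, v) \<in> (edge_rel G)\<^sup>*)"

definition bipartite_wgraph :: "'a wgraph \<Rightarrow> bool" where
  "bipartite_wgraph G \<longleftrightarrow>
     (\<exists>X Y. X \<union> Y = verts G \<and> X \<inter> Y = {} \<and> edge_rel G \<subseteq> X \<times> Y \<union> Y \<times> X)"

definition degree :: "'a wgraph \<Rightarrow> 'a \<Rightarrow> real" where
  "degree G u = (\<Sum>v | (u, v) \<in> edge_rel G. weight G u v)"

definition max_degree :: "'a wgraph \<Rightarrow> real" where
  "max_degree G = Max (degree G ` verts G)"

definition isomorphic_wgraph :: "'a wgraph \<Rightarrow> 'a wgraph \<Rightarrow> bool" where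
  "isomorphic_wgraph G H \<longleftrightarrow>
     (\<exists>f. bij_betw f (verts G) (verts H) \<and>
          (\<forall>u\<in>verts G. \<forall>v\<in>verts G. weight H (f u) (f v) = weight G u v))"

definition wgraph_iso_rel :: "('a wgraph \<times> 'a wgraph) set" where
  "wgraph_iso_rel = {(G, H). wgraph G \<and> wgraph H \<and> isomorphic_wgraph G H}"

lemma equiv_wgraph_iso_rel: "equiv {G :: 'a wgraph. wgraph G} wgraph_iso_rel"
proof (rule equivI)
  show "wgraph_iso_rel \<subseteq> {G. wgraph G} \<times> {G. wgraph G}"
    by (auto simp: wgraph_iso_rel_def)
  show "refl_on {G. wgraph G} wgraph_iso_rel"
    by (auto simp: refl_on_def wgraph_iso_rel_def isomorphic_wgraph_def intro!: exI[of _ id])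
  show "sym (wgraph_iso_rel :: ('a wgraph \<times> 'a wgraph) set)"
  proof (rule symI)
    fix G H :: "'a wgraph" assume "(G, H) \<in> wgraph_iso_rel"
    then obtain f where GH: "wgraph G" "wgraph H" and f: "bij_betw f (verts G) (verts H)"
      and w: "\<forall>u\<in>verts G. \<forall>v\<in>verts G. weight H (f u) (f v) = weight G u v"
      by (auto simp: wgraph_iso_rel_def isomorphic_wgraph_def)
    let ?g = "inv_into (verts G) f"
    have g: "bij_betw ?g (verts H) (verts G)"
      using f by (rule bij_betw_inv_into)
    have "weight G (?g u) (?g v) = weight H u v" if "u \<in> verts H" "v \<in> verts H" for u v
      using w bij_betwE[OF g] bij_betw_inv_into_right[OF f] that by metis
    with g GH show "(H, G) \<in> wgraph_iso_rel"
      unfolding wgraph_iso_rel_def isomorphic_wgraph_def by blast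
  qed
  show "trans (wgraph_iso_rel :: ('a wgraph \<times> 'a wgraph) set)"
  proof (rule transI)
    fix G H K :: "'a wgraph"
    assume "(G, H) \<in> wgraph_iso_rel" "(H, K) \<in> wgraph_iso_rel"
    then obtain f g where GK: "wgraph G" "wgraph K"
      and f: "bij_betw f (verts G) (verts H)" and g: "bij_betw g (verts H) (verts K)"
      and wf: "\<forall>u\<in>verts G. \<forall>v\<in>verts G. weight H (f u) (f v) = weight G u v"
      and wg: "\<forall>u\<in>verts H. \<forall>v\<in>verts H. weight K (g u) (g v) = weight H u v"
      by (auto simp: wgraph_iso_rel_def isomorphic_wgraph_def)
    have "\<forall>u\<in>verts G. \<forall>v\<in>verts G. weight K ((g \<circ> f) u) ((g \<circ> f) v) = weight G u v"
      using wf wg bij_betwE[OF f] by simp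
    with bij_betw_trans[OF f g] GK show "(G, K) \<in> wgraph_iso_rel"
      unfolding wgraph_iso_rel_def isomorphic_wgraph_def by blast
  qed
qed

section \<open>Continuous quantum walks\<close>

text \<open>Square matrices with rows and columns indexed by a finite set \<open>V\<close> are functions of two
  arguments, of which only the values on \<open>V\<close> matter.\<close>

primrec matpow :: "'a set \<Rightarrow> ('a \<Rightarrow> 'a \<Rightarrow> complex) \<Rightarrow> nat \<Rightarrow> 'a \<Rightarrow> 'a \<Rightarrow> complex" where
  "matpow V M 0 = (\<lambda>u v. if u = v then 1 else 0)"
| "matpow V M (Suc j) = (\<lambda>u v. \<Sum>x\<in>V. matpow V M j u x * M x v)"

definition matexp :: "'a set \<Rightarrow> ('a \<Rightarrow> 'a \<Rightarrow> complex) \<Rightarrow> 'a \<Rightarrow> 'a \<Rightarrow> complex" where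
  "matexp V M u v = (\<Sum>j. matpow V M j u v / fact j)"

lemma norm_matpow_le:
  assumes fin: "finite V" and B: "\<And>x y. x \<in> V \<Longrightarrow> y \<in> V \<Longrightarrow> norm (M x y) \<le> B"
    and "u \<in> V" "v \<in> V"
  shows "norm (matpow V M j u v) \<le> (real (card V) * B) ^ j"
  using \<open>v \<in> V\<close>
proof (induction j arbitrary: v)
  case (Suc j)
  have "0 \<le> B"
    using B[OF \<open>u \<in> V\<close> \<open>u \<in> V\<close>] norm_ge_zero order_trans by blast
  have "norm (matpow V M (Suc j) u v) \<le> (\<Sum>x\<in>V. norm (matpow V M j u x * M x v))"
    by (simp add: norm_sum)
  also have "\<dots> \<le> (\<Sum>x\<in>V. (real (card V) * B) ^ j * B)"
    using Suc B \<open>0 \<le> B\<close> by (intro sum_mono) (auto simp: norm_mult intro!: mult_mono)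
  finally show ?case by (simp add: algebra_simps)
qed simp

lemma summable_matexp:
  assumes fin: "finite V" and "u \<in> V" "v \<in> V"
  shows "summable (\<lambda>j. matpow V M j u v / fact j)"
proof -
  define B where "B = Max ((\<lambda>(x, y). norm (M x y)) ` (V \<times> V))"
  have B: "norm (M x y) \<le> B" if "x \<in> V" "y \<in> V" for x y
    unfolding B_def using fin that by (intro Max_ge) auto
  show ?thesis
  proof (rule summable_comparison_test')
    show "summable (\<lambda>j. inverse (fact j) * (real (card V) * B) ^ j)"
      by (rule summable_exp)
    fix j
    show "norm (matpow V M j u v / fact j) \<le> inverse (fact j) * (real (card V) * B) ^ j"
      using norm_matpow_le[OF fin B \<open>u \<in> V\<close> \<open>v \<in> V\<close>, where j = j]
      by (simp add: norm_divide divide_simps)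
  qed
qed

definition transition :: "'a wgraph \<Rightarrow> real \<Rightarrow> 'a \<Rightarrow> 'a \<Rightarrow> complex" where
  "transition G t = matexp (verts G) (\<lambda>u v. \<i> * of_real t * of_real (weight G u v))"

definition local_uniform_mixing :: "'a wgraph \<Rightarrow> 'a \<Rightarrow> bool" where
  "local_uniform_mixing G u \<longleftrightarrow>
     (\<exists>\<tau>>0. \<forall>v\<in>verts G. cmod (transition G \<tau> v u) = 1 / sqrt (card (verts G)))"

end

theory Submission
  imports
    Defs
    "HOL-Complex_Analysis.Complex_Analysis"
    "HOL-Computational_Algebra.Fundamental_Theorem_Algebra"
    "HOL-Library.Function_Algebras"
begin

text \<open>
  Since the graph is bipartite, each entry of the column \<open>U(\<tau>) e\<^sub>u\<close> is real or purely imaginary, so uniform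
  mixing forces it to be one of \<open>\<plusminus>1/\<surd>n\<close>, \<open>\<plusminus>\<i>/\<surd>n\<close>. This column lies in the closed span of the integer
  vectors \<open>A\<^sup>j e\<^sub>u\<close>; by duality over the rationals, an integer multiple of \<open>\<surd>n U(\<tau>) e\<^sub>u\<close> is
  \<open>(P + \<i> Q)(A) e\<^sub>u\<close> with integer polynomials \<open>P\<close> and \<open>Q\<close>. Pairing with an eigenvector shows that
  \<open>exp (2\<i>\<tau>\<rho>)\<close> is algebraic for every eigenvalue \<open>\<rho>\<close> in the support of \<open>u\<close>, that is, for every root of the
  minimal polynomial of \<open>A\<close> relative to \<open>e\<^sub>u\<close>. By the Gelfond--Schneider theorem these roots are pairwise
  linearly dependent over the rationals; as the sum of their squares is rational, each square is
  rational, hence an integer of size at most \<open>k\<^sup>2\<close>. So the minimal polynomial has degree at most \<open>2(k\<^sup>2 + 1)\<close>,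
  which bounds the eccentricity of \<open>u\<close> and with it the number of vertices.

  Gelfond's proof is carried out without number fields: an algebraic number is handled through
  integer matrices having it as an eigenvalue for one fixed eigenvector \<open>\<omega>\<close>, with row sums in the role of
  heights. Siegel's lemma then provides the auxiliary function as well as the Liouville-type lower bound.
\<close>

section \<open>Siegel's lemma and integer matrices\<close>

text \<open>The time \<tau> is an unknown real number, so the algebraicity of exp
  (2\<i>\<tau>\<rho>) says nothing about one eigenvalue alone. Two eigenvalues \<rho> \<noteq> 0 and
  \<sigma> are needed: with \<alpha> = exp (2\<i>\<tau>\<rho>) and \<beta> = \<sigma>/\<rho>, the
  numbers \<alpha>, \<beta> and exp (2\<i>\<tau>\<sigma>), a value of \<alpha> to the power \<beta>,
  are all algebraic, so \<beta> is rational. Bipartiteness supplies the algebraic entries, since a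
  prescribed modulus alone leaves the phase free. The 2 in the exponent comes from squaring, which
  removes \<surd>n.

  If each root is a rational multiple of \<rho>, the sum of the squares of all roots is a positive
  rational times the square of \<rho>. This is why squares become rational while roots such as
  \<surd>2 do not. A root is real and determined by its sign and its square, which is one of 0, ...,
  k*k; this is the origin of 2(k*k + 1).

  The constants in the transcendence part depend on the graph, but only its qualitative conclusion
  is used, so the final bound depends on k alone.\<close>

lemma siegel:
  fixes c :: "'e \<Rightarrow> 'j \<Rightarrow> int" and H :: real
  assumes fE: "finite E" and fJ: "finite J" and ne: "J \<noteq> {}"
    and card: "2 * card E \<le> card J" and H: "1 \<le> H"
    and c: "\<And>e j. e \<in> E \<Longrightarrow> j \<in> J \<Longrightarrow> \<bar>real_of_int (c e j)\<bar> \<le> H"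
  obtains a :: "'j \<Rightarrow> int" where "\<And>j. j \<in> J \<Longrightarrow> \<bar>real_of_int (a j)\<bar> \<le> 2 * real (card J) * H"
    and "\<exists>j\<in>J. a j \<noteq> 0" and "\<And>e. e \<in> E \<Longrightarrow> (\<Sum>j\<in>J. c e j * a j) = 0"
proof -
  define h where "h = nat \<lfloor>H\<rfloor>"
  define Q where "Q = card J"
  \<comment> \<open>This choice makes \<open>2 * (Q * B * h)\<close> equal to \<open>B * B\<close>:
    each equation takes at most \<open>B\<^sup>2 + 1 < (B + 1)\<^sup>2\<close> values, so two
    unknowns per equation are enough for the pigeonhole principle.\<close>
  define B where "B = 2 * Q * h"
  have h1: "1 \<le> h" using H unfolding h_def by linarith
  have Q1: "1 \<le> Q" unfolding Q_def using fJ ne by (simp add: Suc_leI card_gt_0_iff)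
  have ch: "\<bar>c e j\<bar> \<le> int h" if "e \<in> E" "j \<in> J" for e j
    using c[OF that] H unfolding h_def by linarith
  define P where "P = PiE J (\<lambda>_. {0..int B})"
  define T where "T = PiE E (\<lambda>_. {- int (Q * B * h)..int (Q * B * h)})"
  define \<Phi> where "\<Phi> a = restrict (\<lambda>e. \<Sum>j\<in>J. c e j * a j) E" for a :: "'j \<Rightarrow> int"
  have cP: "card P = (B + 1) ^ Q"
    unfolding P_def Q_def by (simp add: card_PiE fJ nat_add_distrib)
  have cT: "card T = (2 * (Q * B * h) + 1) ^ card E"
  proof -
    have "nat (int (Q * B * h) - (- int (Q * B * h)) + 1) = 2 * (Q * B * h) + 1" by linarith
    then show ?thesis unfolding T_def by (simp add: card_PiE fE)
  qed
  have fP: "finite P" and fT: "finite T"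
    unfolding P_def T_def by (auto intro!: finite_PiE fE fJ)
  have "\<Phi> ` P \<subseteq> T"
  proof
    fix y assume "y \<in> \<Phi> ` P"
    then obtain a where a: "a \<in> P" "y = \<Phi> a" by blast
    have "(\<Sum>j\<in>J. c e j * a j) \<in> {- int (Q * B * h)..int (Q * B * h)}" if "e \<in> E" for e
    proof -
      have "\<bar>\<Sum>j\<in>J. c e j * a j\<bar> \<le> (\<Sum>j\<in>J. \<bar>c e j * a j\<bar>)" by (rule sum_abs)
      also have "\<dots> \<le> (\<Sum>j\<in>J. int h * int B)"
      proof (rule sum_mono)
        fix j assume j: "j \<in> J"
        have "\<bar>a j\<bar> \<le> int B" using a(1) j unfolding P_def by (auto simp: PiE_iff)
        then show "\<bar>c e j * a j\<bar> \<le> int h * int B"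
          unfolding abs_mult using ch[OF that j] by (intro mult_mono) auto
      qed
      also have "\<dots> = int (Q * B * h)" by (simp add: Q_def)
      finally show ?thesis by auto
    qed
    then show "y \<in> T" unfolding a(2) \<Phi>_def T_def by auto
  qed
  then have "card (\<Phi> ` P) \<le> card T" using fT card_mono by blast
  also have "card T \<le> (2 * (Q * B * h) + 1) ^ card E" using cT by simp
  \<comment> \<open>Without equations both sides are 1 and strictness fails; then
    \<open>B \<ge> 1\<close> alone makes the box larger than the single value.\<close>
  also have "\<dots> < ((B + 1)\<^sup>2) ^ card E \<or> card E = 0"
  proof (cases "card E = 0")
    case False
    have "2 * (Q * B * h) + 1 < (B + 1)\<^sup>2"
    proof -
      have "(B + 1)\<^sup>2 = B * B + 2 * B + 1" by (simp add: power2_eq_square)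
      moreover have "B * B = 2 * (Q * B * h)" unfolding B_def by simp
      moreover have "B > 0" unfolding B_def using h1 Q1 by simp
      ultimately show ?thesis by simp
    qed
    then show ?thesis using False by (simp add: power_strict_mono)
  qed simp
  then have "(2 * (Q * B * h) + 1) ^ card E < card P"
  proof
    assume *: "(2 * (Q * B * h) + 1) ^ card E < ((B + 1)\<^sup>2) ^ card E"
    have "((B + 1)\<^sup>2) ^ card E = (B + 1) ^ (2 * card E)" by (simp add: power_mult)
    also have "\<dots> \<le> (B + 1) ^ Q" using card unfolding Q_def by (intro power_increasing) auto
    finally show ?thesis using * cP by simp
  next
    assume *: "card E = 0"
    have "(1::nat) < (B + 1) ^ Q" using h1 Q1 unfolding B_def
      by (intro one_less_power) auto
    then show ?thesis using cP * by simp
  qed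
  then have "card (\<Phi> ` P) < card P" 
    using \<open>card (\<Phi> ` P) \<le> card T\<close> cT by simp
  then have "\<not> inj_on \<Phi> P" by (rule pigeonhole)
  then obtain a b where ab: "a \<in> P" "b \<in> P" "a \<noteq> b" "\<Phi> a = \<Phi> b"
    unfolding inj_on_def by blast
  show ?thesis
  proof (rule that[of "\<lambda>j. a j - b j"])
    fix j assume j: "j \<in> J"
    have "a j \<in> {0..int B}" "b j \<in> {0..int B}"
      using ab j unfolding P_def by (auto simp: PiE_iff)
    then have "\<bar>a j - b j\<bar> \<le> int B" by auto
    then have "\<bar>real_of_int (a j - b j)\<bar> \<le> real B" by linarith
    also have "real B = 2 * real (card J) * real h" unfolding B_def Q_def by simp
    also have "\<dots> \<le> 2 * real (card J) * H"
      using H unfolding h_def by (intro mult_left_mono) (auto simp: of_nat_nat)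
    finally show "\<bar>real_of_int (a j - b j)\<bar> \<le> 2 * real (card J) * H" .
  next
    show "\<exists>j\<in>J. a j - b j \<noteq> 0"
    proof (rule ccontr)
      assume "\<not> ?thesis"
      then have "a = b" using ab(1,2) unfolding P_def by (intro PiE_ext[of a J _ b]) auto
      then show False using ab(3) by simp
    qed
  next
    fix e assume "e \<in> E"
    then have "(\<Sum>j\<in>J. c e j * a j) = (\<Sum>j\<in>J. c e j * b j)"
      using fun_cong[OF ab(4), of e] unfolding \<Phi>_def by simp
    then show "(\<Sum>j\<in>J. c e j * (a j - b j)) = 0"
      by (simp add: right_diff_distrib sum_subtractf)
  qed
qed

text \<open>\<open>rep x H\<close> replaces a bound on the absolute values of all conjugates of \<open>x\<close>.\<close>

locale zspan =
  fixes I :: "'i set" and \<omega> :: "'i \<Rightarrow> complex" and i0 :: 'i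
  assumes finI: "finite I" and i0: "i0 \<in> I" and \<omega>0: "\<omega> i0 \<noteq> 0"
begin

definition rep :: "complex \<Rightarrow> real \<Rightarrow> bool" where
  "rep x H \<longleftrightarrow> (\<exists>M :: 'i \<Rightarrow> 'i \<Rightarrow> int. \<forall>i\<in>I.
     x * \<omega> i = (\<Sum>j\<in>I. of_int (M i j) * \<omega> j) \<and> (\<Sum>j\<in>I. \<bar>real_of_int (M i j)\<bar>) \<le> H)"

lemma rep_nonneg: "rep x H \<Longrightarrow> 0 \<le> H"
  unfolding rep_def using i0 by (meson abs_ge_zero order_trans sum_nonneg)

lemma rep_mono: "rep x H \<Longrightarrow> H \<le> H' \<Longrightarrow> rep x H'"
  unfolding rep_def by (meson order_trans)

lemma rep_of_int: "rep (of_int c) \<bar>of_int c\<bar>"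
  unfolding rep_def
proof (intro exI ballI conjI)
  fix i assume i: "i \<in> I"
  show "of_int c * \<omega> i = (\<Sum>j\<in>I. of_int (if i = j then c else 0) * \<omega> j)"
    using i finI by (simp add: if_distrib[of of_int] if_distrib[of "\<lambda>x. x * _"] cong: if_cong)
  show "(\<Sum>j\<in>I. \<bar>real_of_int (if i = j then c else 0)\<bar>) \<le> \<bar>real_of_int c\<bar>"
    using i finI by (simp add: if_distrib[of of_int] if_distrib[of abs] cong: if_cong)
qed

lemma rep_add:
  assumes "rep x H" "rep y H'"
  shows "rep (x + y) (H + H')"
proof -
  obtain M where M: "\<And>i. i \<in> I \<Longrightarrow> x * \<omega> i = (\<Sum>j\<in>I. of_int (M i j) * \<omega> j)"
    "\<And>i. i \<in> I \<Longrightarrow> (\<Sum>j\<in>I. \<bar>real_of_int (M i j)\<bar>) \<le> H" using assms(1) unfolding rep_def by blast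
  obtain N where N: "\<And>i. i \<in> I \<Longrightarrow> y * \<omega> i = (\<Sum>j\<in>I. of_int (N i j) * \<omega> j)"
    "\<And>i. i \<in> I \<Longrightarrow> (\<Sum>j\<in>I. \<bar>real_of_int (N i j)\<bar>) \<le> H'" using assms(2) unfolding rep_def by blast
  show ?thesis unfolding rep_def
  proof (intro exI ballI conjI)
    fix i assume i: "i \<in> I"
    show "(x + y) * \<omega> i = (\<Sum>j\<in>I. of_int (M i j + N i j) * \<omega> j)"
      using M(1)[OF i] N(1)[OF i] by (simp add: algebra_simps sum.distrib)
    have "(\<Sum>j\<in>I. \<bar>real_of_int (M i j + N i j)\<bar>) \<le> (\<Sum>j\<in>I. \<bar>real_of_int (M i j)\<bar> + \<bar>real_of_int (N i j)\<bar>)"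
      by (intro sum_mono) auto
    then show "(\<Sum>j\<in>I. \<bar>real_of_int (M i j + N i j)\<bar>) \<le> H + H'"
      using M(2)[OF i] N(2)[OF i] by (simp add: sum.distrib)
  qed
qed

text \<open>The maximal row sum is submultiplicative. The product matrix is \<open>N\<close> times
  \<open>M\<close>, in this order, because \<open>x\<close> acts on the vectors in the expansion of
  \<open>y * \<omega> i\<close>.\<close>

lemma rep_mult:
  assumes "rep x H" "rep y H'"
  shows "rep (x * y) (H * H')"
proof -
  have H: "0 \<le> H" using rep_nonneg assms(1) .
  obtain M where M: "\<And>i. i \<in> I \<Longrightarrow> x * \<omega> i = (\<Sum>j\<in>I. of_int (M i j) * \<omega> j)"
    "\<And>i. i \<in> I \<Longrightarrow> (\<Sum>j\<in>I. \<bar>real_of_int (M i j)\<bar>) \<le> H" using assms(1) unfolding rep_def by blast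
  obtain N where N: "\<And>i. i \<in> I \<Longrightarrow> y * \<omega> i = (\<Sum>j\<in>I. of_int (N i j) * \<omega> j)"
    "\<And>i. i \<in> I \<Longrightarrow> (\<Sum>j\<in>I. \<bar>real_of_int (N i j)\<bar>) \<le> H'" using assms(2) unfolding rep_def by blast
  show ?thesis unfolding rep_def
  proof (intro exI ballI conjI)
    fix i assume i: "i \<in> I"
    have "(x * y) * \<omega> i = (\<Sum>j\<in>I. of_int (N i j) * (x * \<omega> j))"
      using N(1)[OF i] by (simp add: sum_distrib_left algebra_simps)
    also have "\<dots> = (\<Sum>j\<in>I. \<Sum>k\<in>I. of_int (N i j * M j k) * \<omega> k)"
      by (intro sum.cong refl) (simp add: M(1) sum_distrib_left algebra_simps)
    also have "\<dots> = (\<Sum>k\<in>I. of_int (\<Sum>j\<in>I. N i j * M j k) * \<omega> k)"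
      by (subst sum.swap) (simp add: sum_distrib_right)
    finally show "(x * y) * \<omega> i = (\<Sum>k\<in>I. of_int (\<Sum>j\<in>I. N i j * M j k) * \<omega> k)" .
    have "(\<Sum>k\<in>I. \<bar>real_of_int (\<Sum>j\<in>I. N i j * M j k)\<bar>)
        \<le> (\<Sum>k\<in>I. \<Sum>j\<in>I. \<bar>real_of_int (N i j)\<bar> * \<bar>real_of_int (M j k)\<bar>)"
    proof (rule sum_mono)
      fix k
      have "\<bar>\<Sum>j\<in>I. real_of_int (N i j * M j k)\<bar> \<le> (\<Sum>j\<in>I. \<bar>real_of_int (N i j * M j k)\<bar>)"
        by (rule sum_abs)
      then show "\<bar>real_of_int (\<Sum>j\<in>I. N i j * M j k)\<bar> \<le> (\<Sum>j\<in>I. \<bar>real_of_int (N i j)\<bar> * \<bar>real_of_int (M j k)\<bar>)"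
        by (simp add: abs_mult)
    qed
    also have "\<dots> = (\<Sum>j\<in>I. \<bar>real_of_int (N i j)\<bar> * (\<Sum>k\<in>I. \<bar>real_of_int (M j k)\<bar>))"
      by (subst sum.swap) (simp add: sum_distrib_left)
    also have "\<dots> \<le> (\<Sum>j\<in>I. \<bar>real_of_int (N i j)\<bar> * H)"
      using M(2) by (intro sum_mono mult_left_mono) auto
    also have "\<dots> \<le> H' * H"
      unfolding sum_distrib_right[symmetric] using N(2)[OF i] H by (rule mult_right_mono)
    finally show "(\<Sum>k\<in>I. \<bar>real_of_int (\<Sum>j\<in>I. N i j * M j k)\<bar>) \<le> H * H'" by (simp add: mult.commute)
  qed
qed

lemma rep_power:
  assumes "rep x H"
  shows "rep (x ^ m) (H ^ m)"
proof (induction m)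
  case 0
  show ?case using rep_of_int[of 1] by simp
next
  case (Suc m)
  show ?case using rep_mult[OF assms Suc] by simp
qed

lemma rep_sum:
  assumes "finite J" "\<And>j. j \<in> J \<Longrightarrow> rep (f j) (g j)"
  shows "rep (sum f J) (sum g J)"
  using assms
proof (induction rule: finite_induct)
  case empty
  show ?case using rep_of_int[of 0] by simp
next
  case (insert j J)
  then show ?case using rep_add by simp
qed

text \<open>Siegel's lemma, with the coefficients of the first \<open>2 * card I\<close> powers of
  \<open>x\<close> as unknowns and the coordinates of \<open>x ^ m * \<omega> i0\<close> as
  equations, gives a nonzero integer polynomial vanishing at \<open>x\<close>. After division by the
  lowest power of \<open>x\<close> that occurs, its constant term is a nonzero integer equal to
  \<open>x\<close> times a bounded sum, so \<open>x\<close> cannot be too small.\<close>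

lemma liouville:
  assumes rx: "rep x H" and H: "1 \<le> H" and x: "x \<noteq> 0"
  shows "1 \<le> cmod x * (8 * (real (card I))\<^sup>2 * H ^ (2 * card I))"
proof (cases "cmod x \<le> 1")
  case False
  have D: "1 \<le> real (card I)" using finI i0 card_gt_0_iff[of I] by fastforce
  have "1 \<le> (real (card I))\<^sup>2" "1 \<le> H ^ (2 * card I)" using D H by (auto intro: one_le_power)
  then have "1 \<le> 8 * (real (card I))\<^sup>2 * H ^ (2 * card I)"
    using mult_mono[of 1 "8 * (real (card I))\<^sup>2" 1 "H ^ (2 * card I)"] by simp
  then show ?thesis using False mult_mono[of 1 "cmod x" 1 "8 * (real (card I))\<^sup>2 * H ^ (2 * card I)"] by simp
next
  case True
  define D where "D = card I"
  have D: "1 \<le> D" using finI i0 card_gt_0_iff[of I] unfolding D_def by fastforce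
  define M where "M m = (SOME M. \<forall>i\<in>I. x ^ m * \<omega> i = (\<Sum>j\<in>I. of_int (M i j) * \<omega> j)
      \<and> (\<Sum>j\<in>I. \<bar>real_of_int (M i j)\<bar>) \<le> H ^ m)" for m
  have M: "\<forall>i\<in>I. x ^ m * \<omega> i = (\<Sum>j\<in>I. of_int (M m i j) * \<omega> j)
      \<and> (\<Sum>j\<in>I. \<bar>real_of_int (M m i j)\<bar>) \<le> H ^ m" for m
    unfolding M_def using rep_power[OF rx, of m] unfolding rep_def by (rule someI_ex)
  have bd: "\<bar>real_of_int (M m i0 e)\<bar> \<le> H ^ (2 * D)" if "e \<in> I" "m \<in> {..<2 * D}" for e m
  proof -
    have "\<bar>real_of_int (M m i0 e)\<bar> \<le> (\<Sum>j\<in>I. \<bar>real_of_int (M m i0 j)\<bar>)"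
      using that finI by (intro member_le_sum) auto
    also have "\<dots> \<le> H ^ m" using M[of m] i0 by blast
    also have "\<dots> \<le> H ^ (2 * D)" using that H by (intro power_increasing) auto
    finally show ?thesis .
  qed
  obtain a where a: "\<And>j. j \<in> {..<2 * D} \<Longrightarrow> \<bar>real_of_int (a j)\<bar> \<le> 2 * real (card {..<2 * D}) * H ^ (2 * D)"
    "\<exists>j\<in>{..<2 * D}. a j \<noteq> 0" "\<And>e. e \<in> I \<Longrightarrow> (\<Sum>j<2 * D. M j i0 e * a j) = 0"
    using siegel[of I "{..<2 * D}" "H ^ (2 * D)" "\<lambda>e m. M m i0 e"] finI i0 D H bd
    unfolding D_def by (auto simp: lessThan_empty_iff one_le_power)
  have "(\<Sum>j<2 * D. of_int (a j) * x ^ j) * \<omega> i0 = (\<Sum>j<2 * D. of_int (a j) * (x ^ j * \<omega> i0))"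
    by (simp add: sum_distrib_left sum_distrib_right mult_ac)
  also have "\<dots> = (\<Sum>j<2 * D. \<Sum>e\<in>I. of_int (M j i0 e * a j) * \<omega> e)"
    using M i0 by (intro sum.cong refl) (simp add: sum_distrib_left mult_ac)
  also have "\<dots> = (\<Sum>e\<in>I. of_int (\<Sum>j<2 * D. M j i0 e * a j) * \<omega> e)"
    by (subst sum.swap) (simp add: sum_distrib_right)
  also have "\<dots> = 0" using a(3) by simp
  finally have z: "(\<Sum>j<2 * D. of_int (a j) * x ^ j) = 0" using \<omega>0 by simp
  define j0 where "j0 = (LEAST j. j < 2 * D \<and> a j \<noteq> 0)"
  have j0: "j0 < 2 * D" "a j0 \<noteq> 0"
    using LeastI_ex[of "\<lambda>j. j < 2 * D \<and> a j \<noteq> 0"] a(2) unfolding j0_def by auto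
  have lt: "a j = 0" if "j < j0" for j
    using not_less_Least[of j "\<lambda>j. j < 2 * D \<and> a j \<noteq> 0"] that j0 unfolding j0_def by auto
  define S where "S = (\<Sum>j\<in>{j0<..<2 * D}. of_int (a j) * x ^ (j - j0 - 1))"
  have "(\<Sum>j<2 * D. of_int (a j) * x ^ j) = (\<Sum>j\<in>{j0..<2 * D}. of_int (a j) * x ^ j)"
    using lt by (intro sum.mono_neutral_right) auto
  also have "{j0..<2 * D} = insert j0 {j0<..<2 * D}" using j0 by auto
  also have "(\<Sum>j\<in>insert j0 {j0<..<2 * D}. of_int (a j) * x ^ j)
      = of_int (a j0) * x ^ j0 + (\<Sum>j\<in>{j0<..<2 * D}. of_int (a j) * x ^ j)" by simp
  also have "(\<Sum>j\<in>{j0<..<2 * D}. of_int (a j) * x ^ j) = x ^ j0 * (x * S)"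
    unfolding S_def sum_distrib_left
    by (intro sum.cong refl) (simp add: mult_ac flip: power_Suc power_add)
  finally have "x ^ j0 * (of_int (a j0) + x * S) = 0" using z by (simp add: algebra_simps)
  then have e: "of_int (a j0) = - (x * S)" using x by (simp add: eq_neg_iff_add_eq_0)
  have "cmod S \<le> (\<Sum>j\<in>{j0<..<2 * D}. 4 * real D * H ^ (2 * D))"
    unfolding S_def
  proof (rule sum_norm_le)
    fix j assume j: "j \<in> {j0<..<2 * D}"
    have "cmod (of_int (a j) * x ^ (j - j0 - 1)) = \<bar>real_of_int (a j)\<bar> * cmod x ^ (j - j0 - 1)"
      by (simp add: norm_mult norm_power)
    also have "\<dots> \<le> (4 * real D * H ^ (2 * D)) * 1"
      using a(1)[of j] j True H by (intro mult_mono power_le_one) auto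
    finally show "cmod (of_int (a j) * x ^ (j - j0 - 1)) \<le> 4 * real D * H ^ (2 * D)" by simp
  qed
  also have "\<dots> \<le> real (2 * D) * (4 * real D * H ^ (2 * D))"
    unfolding sum_constant using H by (intro mult_right_mono) auto
  finally have S: "cmod S \<le> 8 * (real D)\<^sup>2 * H ^ (2 * D)" by (simp add: power2_eq_square)
  have "1 \<le> \<bar>real_of_int (a j0)\<bar>" using j0(2) by linarith
  also have "\<dots> = cmod x * cmod S" using arg_cong[OF e, of cmod] by (simp add: norm_mult)
  also have "\<dots> \<le> cmod x * (8 * (real D)\<^sup>2 * H ^ (2 * D))" using S by (intro mult_left_mono) auto
  finally show ?thesis unfolding D_def .
qed

end

section \<open>Exponential sums\<close>

text \<open>What remains of \<open>exp x\<close> when the Taylor polynomial of degree below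
  \<open>r\<close> is removed and the rest is divided by \<open>x ^ r\<close>; as a power series it
  needs no case distinction at 0.\<close>

definition exp_tail :: "nat \<Rightarrow> complex \<Rightarrow> complex" where
  "exp_tail r x = (\<Sum>j. x ^ j / fact (r + j))"

lemma summable_exp_tail: "summable (\<lambda>j. x ^ j / fact (r + j) :: complex)"
proof (rule summable_comparison_test')
  show "summable (\<lambda>j. inverse (fact j) * cmod x ^ j)" by (rule summable_exp)
  fix j
  have "(fact j :: real) \<le> fact (r + j)" by (intro fact_mono) auto
  then show "norm (x ^ j / fact (r + j)) \<le> inverse (fact j) * cmod x ^ j"
    by (simp add: norm_divide norm_power divide_simps mult_left_mono)
qed

lemma exp_tail_0: "exp_tail r 0 = 1 / fact r"
  unfolding exp_tail_def by (subst suminf_finite[of "{0}"]) auto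

lemma holomorphic_exp_tail: "exp_tail r holomorphic_on UNIV"
proof -
  have "exp_tail r holomorphic_on ball 0 (cmod z + 1)" for z
  proof (rule power_series_holomorphic[where a = "\<lambda>j. 1 / fact (r + j)"])
    fix w :: complex
    show "(\<lambda>n. 1 / fact (r + n) * (w - 0) ^ n) sums exp_tail r w"
      using summable_sums[OF summable_exp_tail[of w r]] unfolding exp_tail_def by simp
  qed
  then have "exp_tail r field_differentiable at z" for z
    by (rule holomorphic_on_imp_differentiable_at[of _ "ball 0 (cmod z + 1)"]) auto
  then show ?thesis by (simp add: holomorphic_on_def)
qed

lemma exp_eq_exp_tail: "exp x = (\<Sum>t<r. x ^ t / fact t) + x ^ r * exp_tail r x"
proof -
  have "(\<lambda>n. x ^ n / fact n) sums exp x"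
    using exp_converges[of x] by (simp add: scaleR_conv_of_real divide_inverse mult.commute)
  from sums_split_initial_segment[OF this, of r]
  have 1: "(\<lambda>n. x ^ (n + r) / fact (n + r)) sums (exp x - (\<Sum>t<r. x ^ t / fact t))" .
  have "(\<lambda>j. x ^ r * (x ^ j / fact (r + j))) sums (x ^ r * exp_tail r x)"
    unfolding exp_tail_def by (intro sums_mult summable_sums summable_exp_tail)
  then have "(\<lambda>n. x ^ (n + r) / fact (n + r)) sums (x ^ r * exp_tail r x)"
    by (simp add: power_add add.commute mult.commute)
  from sums_unique2[OF 1 this] show ?thesis by (simp add: algebra_simps)
qed

text \<open>The hypothesis says that the derivatives of order below \<open>r\<close> vanish at
  \<open>p\<close>. Expanding each exponential about \<open>p\<close> cancels the Taylor part and
  leaves an explicit entire quotient, whose value at \<open>p\<close> is the \<open>r\<close>-th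
  derivative over \<open>fact r\<close>.\<close>

lemma exp_sum_factor:
  fixes c w :: "'j \<Rightarrow> complex"
  assumes "finite J" "\<And>t. t < r \<Longrightarrow> (\<Sum>j\<in>J. c j * w j ^ t * exp (w j * p)) = 0"
  obtains g where "g holomorphic_on UNIV"
    "\<And>z. (\<Sum>j\<in>J. c j * exp (w j * z)) = (z - p) ^ r * g z"
    "g p = (\<Sum>j\<in>J. c j * w j ^ r * exp (w j * p)) / fact r"
proof
  let ?g = "\<lambda>z. \<Sum>j\<in>J. c j * exp (w j * p) * w j ^ r * exp_tail r (w j * (z - p))"
  have h: "(\<lambda>z. exp_tail r (w j * (z - p))) holomorphic_on UNIV" for j
    using holomorphic_on_compose[of "\<lambda>z. w j * (z - p)" UNIV "exp_tail r"]
    by (simp add: o_def holomorphic_intros holomorphic_on_subset[OF holomorphic_exp_tail])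
  show "?g holomorphic_on UNIV" by (intro holomorphic_intros h)
  show "?g p = (\<Sum>j\<in>J. c j * w j ^ r * exp (w j * p)) / fact r"
    by (simp add: exp_tail_0 sum_divide_distrib mult_ac)
  fix z
  have "(\<Sum>j\<in>J. c j * exp (w j * z)) = (\<Sum>j\<in>J. c j * exp (w j * p) * exp (w j * (z - p)))"
    by (intro sum.cong refl) (simp add: algebra_simps flip: exp_add)
  also have "\<dots> = (\<Sum>j\<in>J. c j * exp (w j * p) * (\<Sum>t<r. (w j * (z - p)) ^ t / fact t))
      + (\<Sum>j\<in>J. c j * exp (w j * p) * ((w j * (z - p)) ^ r * exp_tail r (w j * (z - p))))"
    unfolding sum.distrib[symmetric] by (intro sum.cong refl) (simp add: exp_eq_exp_tail[of _ r] algebra_simps)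
  also have "(\<Sum>j\<in>J. c j * exp (w j * p) * (\<Sum>t<r. (w j * (z - p)) ^ t / fact t))
      = (\<Sum>t<r. (z - p) ^ t / fact t * (\<Sum>j\<in>J. c j * w j ^ t * exp (w j * p)))"
    unfolding sum_distrib_left by (subst sum.swap) (simp add: power_mult_distrib mult_ac)
  also have "\<dots> = 0" using assms(2) by simp
  also have "(\<Sum>j\<in>J. c j * exp (w j * p) * ((w j * (z - p)) ^ r * exp_tail r (w j * (z - p))))
      = (z - p) ^ r * ?g z"
    unfolding sum_distrib_left by (intro sum.cong refl) (simp add: power_mult_distrib mult_ac)
  finally show "(\<Sum>j\<in>J. c j * exp (w j * z)) = (z - p) ^ r * ?g z" by simp
qed

text \<open>The maximum principle for \<open>F\<close> divided by all the
  \<open>(z - q) ^ r\<close>: on the circle of radius \<open>R\<close> each \<open>z - q\<close> has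
  modulus at least \<open>R / 2\<close>. The local quotients \<open>g p\<close> remove the
  singularities explicitly.\<close>

lemma zeros_bound:
  fixes F :: "complex \<Rightarrow> complex" and P :: "complex set"
  assumes fin: "finite P" and F: "F holomorphic_on UNIV"
    and g: "\<And>p. p \<in> P \<Longrightarrow> g p holomorphic_on UNIV"
    and Fg: "\<And>p z. p \<in> P \<Longrightarrow> F z = (z - p) ^ r * g p z"
    and p: "p \<in> P" and R: "0 < R" and PR: "\<And>q. q \<in> P \<Longrightarrow> cmod q \<le> R / 2"
    and B: "\<And>z. cmod z = R \<Longrightarrow> cmod (F z) \<le> B"
  shows "cmod (g p p) \<le> B * (2 / R) ^ (r * card P) * (\<Prod>q\<in>P - {p}. cmod (p - q) ^ r)"
proof -
  define G where "G z = (if z \<in> P then g z z / (\<Prod>q\<in>P - {z}. (z - q) ^ r)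
     else F z / (\<Prod>q\<in>P. (z - q) ^ r))" for z
  \<comment> \<open>Away from the other zeros \<open>G\<close> is this single formula, which is
    holomorphic at \<open>q\<close> too; this settles the points where the piecewise definition
    changes.\<close>
  have Gloc: "G z = g q z / (\<Prod>q'\<in>P - {q}. (z - q') ^ r)" if "q \<in> P" "z \<notin> P - {q}" for z q
  proof (cases "z = q")
    case False
    then have z: "z \<notin> P" using that by auto
    have "(\<Prod>q\<in>P. (z - q) ^ r) = (z - q) ^ r * (\<Prod>q'\<in>P - {q}. (z - q') ^ r)"
      using fin that by (simp add: prod.remove)
    then show ?thesis unfolding G_def using z Fg[OF that(1), of z] False by simp
  qed (use that in \<open>simp add: G_def\<close>)
  have "G field_differentiable at z" for z
  proof (cases "z \<in> P")
    case True
    have op: "open (- (P - {z}))" using fin by (intro open_Compl finite_imp_closed) auto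
    have "(\<lambda>x. g z x / (\<Prod>q'\<in>P - {z}. (x - q') ^ r)) holomorphic_on - (P - {z})"
      using g[OF True] fin
      by (intro holomorphic_intros) (auto intro: holomorphic_on_subset)
    then have "G holomorphic_on - (P - {z})"
      by (rule holomorphic_transform) (use Gloc[OF True] in auto)
    then show ?thesis using op by (rule holomorphic_on_imp_differentiable_at) auto
  next
    case False
    have op: "open (- P)" using fin by (simp add: finite_imp_closed open_Compl)
    have "(\<lambda>x. F x / (\<Prod>q'\<in>P. (x - q') ^ r)) holomorphic_on - P"
      using F fin by (intro holomorphic_intros) (auto intro: holomorphic_on_subset)
    then have "G holomorphic_on - P"
      by (rule holomorphic_transform) (auto simp: G_def)
    then show ?thesis using op False by (intro holomorphic_on_imp_differentiable_at[of _ "- P"]) auto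
  qed
  then have G: "G holomorphic_on UNIV" by (simp add: holomorphic_on_def)
  have "cmod (G p) \<le> B * (2 / R) ^ (r * card P)"
  proof (rule maximum_modulus_frontier[of G "cball 0 R"])
    show "G holomorphic_on interior (cball 0 R)" using G holomorphic_on_subset by blast
    show "continuous_on (closure (cball 0 R)) G"
      using holomorphic_on_imp_continuous_on[OF G] continuous_on_subset by blast
    show "bounded (cball (0::complex) R)" by simp
    show "p \<in> cball 0 R" using PR[OF p] R by simp
    fix z assume "z \<in> frontier (cball (0::complex) R)"
    then have z: "cmod z = R" using R by (simp add: frontier_cball)
    then have zP: "z \<notin> P" using PR[of z] R by auto
    have "(R / 2) ^ (r * card P) = (\<Prod>q\<in>P. (R / 2) ^ r)"
      by (simp add: power_mult)
    also have "\<dots> \<le> (\<Prod>q\<in>P. cmod (z - q) ^ r)"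
    proof (rule prod_mono)
      fix q assume "q \<in> P"
      then have "R / 2 \<le> cmod (z - q)" using PR[of q] z norm_triangle_ineq2[of z q] by linarith
      then show "0 \<le> (R / 2) ^ r \<and> (R / 2) ^ r \<le> cmod (z - q) ^ r"
        using R by (auto intro: power_mono)
    qed
    also have "\<dots> = cmod (\<Prod>q\<in>P. (z - q) ^ r)" by (simp add: norm_power flip: prod_norm)
    finally have den: "(R / 2) ^ (r * card P) \<le> cmod (\<Prod>q\<in>P. (z - q) ^ r)" .
    have pos: "0 < (R / 2) ^ (r * card P)" using R by simp
    have "cmod (G z) = cmod (F z) / cmod (\<Prod>q\<in>P. (z - q) ^ r)"
      unfolding G_def using zP by (simp add: norm_divide)
    also have "\<dots> \<le> B / (R / 2) ^ (r * card P)"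
      using B[OF z] den pos order_trans[OF norm_ge_zero B[OF z]] by (intro frac_le) auto
    also have "\<dots> = B * (2 / R) ^ (r * card P)" by (simp add: power_divide)
    finally show "cmod (G z) \<le> B * (2 / R) ^ (r * card P)" .
  qed
  moreover have "g p p = G p * (\<Prod>q\<in>P - {p}. (p - q) ^ r)"
    using Gloc[OF p, of p] fin by (simp add: divide_simps)
  then have "cmod (g p p) = cmod (G p) * (\<Prod>q\<in>P - {p}. cmod (p - q) ^ r)"
    by (simp add: norm_mult norm_power flip: prod_norm)
  ultimately show ?thesis by (simp add: mult_right_mono prod_nonneg)
qed

text \<open>A Vandermonde argument: vanishing for all \<open>t\<close> extends from monomials to
  every polynomial, and the one with roots at all the other \<open>w i\<close> isolates
  \<open>c j\<close>. The sums are the derivatives of the exponential sum at 0.\<close>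

lemma exp_sum_nonzero_derivative:
  fixes c w :: "'j \<Rightarrow> complex"
  assumes "finite J" "inj_on w J" "j \<in> J" "c j \<noteq> 0"
  shows "\<exists>t. (\<Sum>j\<in>J. c j * w j ^ t) \<noteq> 0"
proof (rule ccontr)
  assume "\<not> ?thesis"
  then have z: "(\<Sum>j\<in>J. c j * w j ^ t) = 0" for t by blast
  have pz: "(\<Sum>j\<in>J. c j * poly p (w j)) = 0" for p
  proof -
    have "(\<Sum>j\<in>J. c j * poly p (w j)) = (\<Sum>t\<le>Polynomial.degree p. coeff p t * (\<Sum>j\<in>J. c j * w j ^ t))"
      unfolding poly_altdef sum_distrib_left by (subst sum.swap) (simp add: mult_ac)
    then show ?thesis using z by simp
  qed
  define p where "p = (\<Prod>i\<in>J - {j}. [:- w i, 1:])"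
  have "(\<Sum>i\<in>J. c i * poly p (w i)) = c j * poly p (w j) + (\<Sum>i\<in>J - {j}. c i * poly p (w i))"
    using assms by (simp add: sum.remove)
  also have "(\<Sum>i\<in>J - {j}. c i * poly p (w i)) = 0"
  proof (rule sum.neutral, rule ballI)
    fix i assume i: "i \<in> J - {j}"
    have "poly p (w i) = 0" unfolding p_def poly_prod
      using i assms(1) by (auto intro!: prod_zero)
    then show "c i * poly p (w i) = 0" by simp
  qed
  finally have "poly p (w j) = 0" using pz[of p] assms(4) by simp
  then obtain i where "i \<in> J - {j}" "w j - w i = 0"
    unfolding p_def poly_prod using assms(1) by (auto simp: prod_zero_iff)
  then show False using assms(2,3) by (auto simp: inj_on_def)
qed

section \<open>The Gelfond--Schneider theorem\<close>

lemma one_le_mult: "1 \<le> a * b" if "1 \<le> a" "1 \<le> b" for a b :: real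
  using mult_mono[OF that] that by simp

text \<open>The auxiliary function is \<open>F z = \<Sum> a (j, l) exp ((j x + l y) z)\<close> with \<open>j, l < q\<close>, considered at the points
  \<open>\<tau> s\<close> with \<open>s < m\<close>. There its derivatives become, after multiplication by \<open>M\<^bsup>2qm\<^esup>\<close>, integer polynomials in
  \<open>x\<close>, \<open>y\<close>, \<open>h1\<close>, \<open>h2\<close>. The value \<open>auxval q a t s\<close> below is the \<open>t\<close>-th derivative of \<open>F\<close> at \<open>\<tau> s\<close>.\<close>

locale exp_zspan = zspan I \<omega> i0 for I :: "'i set" and \<omega> i0 +
  fixes x y \<tau> h1 h2 :: complex and M :: int and K :: real
  assumes K1: "1 \<le> K" and rep_x: "rep x K" and rep_y: "rep y K"
    and rep_h1: "rep h1 K" and rep_h2: "rep h2 K" and M0: "M \<noteq> 0" and MK: "\<bar>of_int M\<bar> \<le> K"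
    and norm_x: "cmod x \<le> K" and norm_y: "cmod y \<le> K"
    and \<tau>0: "\<tau> \<noteq> 0" and norm_\<tau>: "cmod \<tau> \<le> K"
    and h1: "of_int M * exp (\<tau> * x) = h1" and h2: "of_int M * exp (\<tau> * y) = h2"
    and indep: "\<And>a b :: int. of_int a * x + of_int b * y = 0 \<Longrightarrow> a = 0 \<and> b = 0"
begin

definition freq :: "nat \<times> nat \<Rightarrow> complex" where
  "freq p = of_nat (fst p) * x + of_nat (snd p) * y"

text \<open>The independence of \<open>x\<close> and \<open>y\<close> enters the argument here:
  distinct frequencies keep the auxiliary function from vanishing identically.\<close>

lemma inj_freq: "inj freq"
proof (rule injI)
  fix p p' assume "freq p = freq p'"
  then have "of_int (int (fst p) - int (fst p')) * x + of_int (int (snd p) - int (snd p')) * y = 0"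
    unfolding freq_def by (simp add: algebra_simps)
  from indep[OF this] show "p = p'" by (simp add: prod_eq_iff)
qed

lemma rep_freq:
  assumes "p \<in> {..<q} \<times> {..<q}"
  shows "rep (freq p) (2 * real q * K)"
proof -
  have r: "rep (of_int (int (fst p)) * x + of_int (int (snd p)) * y)
      (\<bar>of_int (int (fst p))\<bar> * K + \<bar>of_int (int (snd p))\<bar> * K)"
    by (intro rep_add rep_mult rep_of_int rep_x rep_y)
  have "real (fst p) * K \<le> real q * K" "real (snd p) * K \<le> real q * K"
    using assms K1 by (auto intro!: mult_right_mono)
  then show ?thesis using rep_mono[OF r, of "2 * real q * K"] unfolding freq_def by simp
qed

lemma norm_freq:
  assumes "p \<in> {..<q} \<times> {..<q}"
  shows "cmod (freq p) \<le> 2 * real q * K"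
proof -
  have "cmod (freq p) \<le> real (fst p) * cmod x + real (snd p) * cmod y"
    unfolding freq_def by (rule norm_triangle_le) (simp add: norm_mult)
  also have "\<dots> \<le> real q * K + real q * K"
    using assms norm_x norm_y K1 by (intro add_mono mult_mono) auto
  finally show ?thesis by (simp add: mult_ac)
qed

text \<open>The exponential is
  \<open>exp (\<tau> * x) ^ (j * s) * exp (\<tau> * y) ^ (l * s)\<close>, and each factor needs one
  \<open>M\<close> to become \<open>h1\<close> or \<open>h2\<close>. Since
  \<open>j * s + l * s \<le> 2 * q * m\<close>, one common power of \<open>M\<close> clears all
  denominators, and the surplus \<open>M ^ e\<close> costs at most \<open>K ^ e\<close>.\<close>

lemma rep_term:
  assumes p: "p \<in> {..<q} \<times> {..<q}" and s: "s < m"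
  shows "rep (of_int M ^ (2 * q * m) * (freq p ^ t * exp (freq p * (\<tau> * of_nat s))))
     ((2 * real q * K) ^ t * K ^ (2 * q * m))"
proof -
  obtain j l where jl: "p = (j, l)" "j < q" "l < q" using p by auto
  have le: "j * s + l * s \<le> 2 * q * m"
  proof -
    have "j * s \<le> q * m" "l * s \<le> q * m" using jl s by (auto intro!: mult_le_mono)
    then show ?thesis by simp
  qed
  define e where "e = 2 * q * m - (j * s + l * s)"
  have e: "2 * q * m = e + (j * s + l * s)" using le unfolding e_def by simp
  have h1s: "h1 ^ (j * s) = of_int M ^ (j * s) * exp (of_nat (j * s) * (\<tau> * x))"
    unfolding h1[symmetric] by (simp add: power_mult_distrib exp_of_nat_mult del: of_nat_mult)
  have h2s: "h2 ^ (l * s) = of_int M ^ (l * s) * exp (of_nat (l * s) * (\<tau> * y))"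
    unfolding h2[symmetric] by (simp add: power_mult_distrib exp_of_nat_mult del: of_nat_mult)
  have ex: "exp (freq p * (\<tau> * of_nat s)) = exp (of_nat (j * s) * (\<tau> * x)) * exp (of_nat (l * s) * (\<tau> * y))"
    unfolding freq_def jl by (simp add: algebra_simps flip: exp_add)
  have eq: "of_int M ^ (2 * q * m) * (freq p ^ t * exp (freq p * (\<tau> * of_nat s)))
      = freq p ^ t * (of_int M ^ e * (h1 ^ (j * s) * h2 ^ (l * s)))"
    unfolding e h1s h2s ex power_add by (simp add: mult_ac)
  have rM: "rep (of_int M) K" using rep_mono[OF rep_of_int MK] .
  have "rep (freq p ^ t * (of_int M ^ e * (h1 ^ (j * s) * h2 ^ (l * s))))
      ((2 * real q * K) ^ t * (K ^ e * (K ^ (j * s) * K ^ (l * s))))"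
    by (intro rep_mult rep_power rep_freq[OF p] rM rep_h1 rep_h2)
  then show ?thesis by (subst eq) (simp only: e power_add)
qed

definition auxval :: "nat \<Rightarrow> (nat \<times> nat \<Rightarrow> int) \<Rightarrow> nat \<Rightarrow> nat \<Rightarrow> complex" where
  "auxval q a t s = (\<Sum>p\<in>{..<q} \<times> {..<q}. of_int (a p) * freq p ^ t * exp (freq p * (\<tau> * of_nat s)))"

text \<open>There are \<open>q\<^sup>2\<close> unknown coefficients, and one equation for each of
  \<open>n\<close> derivatives, \<open>m\<close> points and \<open>card I\<close> coordinates. Only
  the row of \<open>i0\<close> is imposed: as \<open>\<omega> i0 \<noteq> 0\<close>, it already
  forces the value to vanish.\<close>

lemma auxiliary_function:
  assumes q: "1 \<le> q" and qn: "2 * m * card I * n \<le> q\<^sup>2"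
  obtains a where
    "\<And>p. p \<in> {..<q} \<times> {..<q} \<Longrightarrow> \<bar>real_of_int (a p)\<bar> \<le> 2 * real q ^ 2 * ((2 * real q * K) ^ n * K ^ (2 * q * m))"
    "\<exists>p\<in>{..<q} \<times> {..<q}. a p \<noteq> 0" "\<And>t s. t < n \<Longrightarrow> s < m \<Longrightarrow> auxval q a t s = 0"
proof -
  let ?J = "{..<q} \<times> {..<q}"
  let ?X = "\<lambda>p t s. of_int M ^ (2 * q * m) * (freq p ^ t * exp (freq p * (\<tau> * of_nat s)))"
  let ?P = "\<lambda>p t s N. \<forall>i\<in>I. ?X p t s * \<omega> i = (\<Sum>j\<in>I. of_int (N i j) * \<omega> j)
      \<and> (\<Sum>j\<in>I. \<bar>real_of_int (N i j)\<bar>) \<le> (2 * real q * K) ^ t * K ^ (2 * q * m)"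
  define N where "N p t s = (SOME N. ?P p t s N)" for p t s
  have N: "?P p t s (N p t s)" if "p \<in> ?J" "s < m" for p t s
    unfolding N_def using rep_term[OF that, of t] unfolding rep_def by (rule someI_ex)
  let ?H = "(2 * real q * K) ^ n * K ^ (2 * q * m)"
  let ?E = "{..<n} \<times> {..<m} \<times> I"
  have qK: "1 \<le> 2 * real q * K" using q K1 mult_mono[of 1 "2 * real q" 1 K] by simp
  have H1: "1 \<le> ?H" by (rule one_le_mult[OF one_le_power[OF qK] one_le_power[OF K1]])
  have bd: "\<bar>real_of_int ((\<lambda>(t, s, i) p. N p t s i0 i) e p)\<bar> \<le> ?H" if ep: "e \<in> ?E" "p \<in> ?J" for e p
  proof -
    obtain t s i where e: "e = (t, s, i)" "t < n" "s < m" "i \<in> I" using ep by auto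
    have "\<bar>real_of_int (N p t s i0 i)\<bar> \<le> (\<Sum>j\<in>I. \<bar>real_of_int (N p t s i0 j)\<bar>)"
      using e finI by (intro member_le_sum) auto
    also have "\<dots> \<le> (2 * real q * K) ^ t * K ^ (2 * q * m)" using N[OF ep(2) e(3)] i0 by blast
    also have "\<dots> \<le> ?H" using e qK K1 by (intro mult_right_mono power_increasing) auto
    finally show ?thesis unfolding e by simp
  qed
  have cE: "2 * card ?E \<le> card ?J" using qn by (simp add: card_cartesian_product power2_eq_square mult_ac)
  obtain a where a: "\<And>p. p \<in> ?J \<Longrightarrow> \<bar>real_of_int (a p)\<bar> \<le> 2 * real (card ?J) * ?H"
    "\<exists>p\<in>?J. a p \<noteq> 0" "\<And>e. e \<in> ?E \<Longrightarrow> (\<Sum>p\<in>?J. (\<lambda>(t, s, i) p. N p t s i0 i) e p * a p) = 0"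
    by (rule siegel[of ?E ?J ?H "\<lambda>(t, s, i) p. N p t s i0 i", OF _ _ _ cE H1 bd])
       (use finI q in \<open>auto simp: lessThan_empty_iff\<close>)
  show ?thesis
  proof (rule that[of a])
    fix p assume "p \<in> ?J"
    then show "\<bar>real_of_int (a p)\<bar> \<le> 2 * real q ^ 2 * ?H"
      using a(1)[of p] by (simp add: card_cartesian_product power2_eq_square)
  next
    show "\<exists>p\<in>?J. a p \<noteq> 0" by (rule a(2))
  next
    fix t s assume ts: "t < n" "s < m"
    have "of_int M ^ (2 * q * m) * auxval q a t s * \<omega> i0 = (\<Sum>p\<in>?J. of_int (a p) * (?X p t s * \<omega> i0))"
      unfolding auxval_def by (simp add: sum_distrib_left sum_distrib_right mult_ac)
    also have "\<dots> = (\<Sum>p\<in>?J. of_int (a p) * (\<Sum>i\<in>I. of_int (N p t s i0 i) * \<omega> i))"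
      using N ts i0 by (intro sum.cong refl arg_cong2[of _ _ _ _ "(*)"]) blast
    also have "\<dots> = (\<Sum>p\<in>?J. \<Sum>i\<in>I. of_int (N p t s i0 i * a p) * \<omega> i)"
      by (simp add: sum_distrib_left mult_ac)
    also have "\<dots> = (\<Sum>i\<in>I. of_int (\<Sum>p\<in>?J. N p t s i0 i * a p) * \<omega> i)"
      by (subst sum.swap) (simp add: sum_distrib_right)
    also have "\<dots> = 0" using a(3) ts by (intro sum.neutral) force
    finally show "auxval q a t s = 0" using M0 \<omega>0 by simp
  qed
qed

text \<open>This is \<open>liouville\<close> for \<open>M ^ (2 * q * m) * auxval q a r s\<close>, a
  sum of \<open>q\<^sup>2\<close> terms controlled by \<open>rep_term\<close>.\<close>

lemma norm_auxval_ge: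
  assumes s: "s < m" and nz: "auxval q a r s \<noteq> 0" and q: "1 \<le> q" and B: "1 \<le> B"
    and a: "\<And>p. p \<in> {..<q} \<times> {..<q} \<Longrightarrow> \<bar>real_of_int (a p)\<bar> \<le> B"
  shows "1 \<le> K ^ (2 * q * m) * cmod (auxval q a r s) * (8 * (real (card I))\<^sup>2
     * (real q ^ 2 * B * ((2 * real q * K) ^ r * K ^ (2 * q * m))) ^ (2 * card I))"
proof -
  let ?J = "{..<q} \<times> {..<q}"
  let ?H = "real q ^ 2 * B * ((2 * real q * K) ^ r * K ^ (2 * q * m))"
  let ?x = "of_int M ^ (2 * q * m) * auxval q a r s"
  have qK: "1 \<le> 2 * real q * K" using q K1 mult_mono[of 1 "2 * real q" 1 K] by simp
  have H0: "1 \<le> (2 * real q * K) ^ r * K ^ (2 * q * m)"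
    by (rule one_le_mult[OF one_le_power[OF qK] one_le_power[OF K1]])
  have "1 \<le> real q ^ 2 * B" using q B by (intro one_le_mult one_le_power) auto
  from one_le_mult[OF this H0] have H1: "1 \<le> ?H" .
  have "rep ?x (\<Sum>p\<in>?J. B * ((2 * real q * K) ^ r * K ^ (2 * q * m)))"
  proof -
    have "?x = (\<Sum>p\<in>?J. of_int (a p) * (of_int M ^ (2 * q * m) * (freq p ^ r * exp (freq p * (\<tau> * of_nat s)))))"
      unfolding auxval_def by (simp add: sum_distrib_left mult_ac)
    moreover have "rep \<dots> (\<Sum>p\<in>?J. B * ((2 * real q * K) ^ r * K ^ (2 * q * m)))"
      by (intro rep_sum rep_mult rep_term s rep_mono[OF rep_of_int a]) auto
    ultimately show ?thesis by simp
  qed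
  then have "rep ?x ?H" by (simp add: card_cartesian_product power2_eq_square mult_ac)
  from liouville[OF this H1] have "1 \<le> cmod ?x * (8 * (real (card I))\<^sup>2 * ?H ^ (2 * card I))"
    using M0 nz by simp
  also have "\<dots> \<le> (K ^ (2 * q * m) * cmod (auxval q a r s)) * (8 * (real (card I))\<^sup>2 * ?H ^ (2 * card I))"
  proof (rule mult_right_mono)
    show "cmod ?x \<le> K ^ (2 * q * m) * cmod (auxval q a r s)"
      using MK by (auto simp: norm_mult norm_power intro!: mult_right_mono power_mono)
    show "0 \<le> 8 * (real (card I))\<^sup>2 * ?H ^ (2 * card I)" using H1 by (intro mult_nonneg_nonneg) auto
  qed
  finally show ?thesis .
qed

text \<open>By \<open>exp_sum_factor\<close> the value is \<open>fact r\<close> times a local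
  quotient of the auxiliary function, and \<open>zeros_bound\<close> exploits its zeros of order
  \<open>r\<close> at all \<open>m\<close> points.\<close>

lemma norm_auxval_le:
  assumes z: "\<And>t s. t < r \<Longrightarrow> s < m \<Longrightarrow> auxval q a t s = 0" and s: "s < m"
    and a: "\<And>p. p \<in> {..<q} \<times> {..<q} \<Longrightarrow> \<bar>real_of_int (a p)\<bar> \<le> B" and B: "1 \<le> B"
    and q: "1 \<le> q" and r: "2 * K * real m * real q \<le> real r"
  shows "cmod (auxval q a r s) \<le> fact r * (real q ^ 2 * B * exp (2 * K * real r)
     * (2 * real q / real r) ^ (r * m) * (K * real m) ^ (r * m))"
proof -
  let ?J = "{..<q} \<times> {..<q}"
  define pt where "pt s = \<tau> * of_nat s" for s :: nat
  define P where "P = pt ` {..<m}"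
  \<comment> \<open>Frequencies have size at most \<open>2 * q * K\<close>, so this radius keeps the
    exponentials below \<open>exp (2 * K * r)\<close>, an \<open>r\<close>-th power, while the lower
    bound on \<open>r\<close> keeps all points \<open>pt s\<close> within
    \<open>R / 2\<close>.\<close>
  define R where "R = real r / real q"
  have m: "1 \<le> m" using s by simp
  have injpt: "inj_on pt {..<m}" unfolding pt_def using \<tau>0 by (auto simp: inj_on_def)
  have cP: "card P = m" unfolding P_def using injpt by (simp add: card_image)
  have Km: "1 \<le> K * real m" using K1 m mult_mono[of 1 K 1 "real m"] by simp
  have R2: "2 * (K * real m) \<le> R" unfolding R_def using r q by (simp add: field_simps)
  have R: "0 < R" using R2 Km by simp
  define F where "F z = (\<Sum>p\<in>?J. of_int (a p) * exp (freq p * z))" for z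
  have "\<exists>g. g holomorphic_on UNIV \<and> (\<forall>z. F z = (z - pt s) ^ r * g z) \<and> g (pt s) = auxval q a r s / fact r"
    if "s < m" for s
  proof -
    have *: "\<And>t. t < r \<Longrightarrow> (\<Sum>p\<in>?J. of_int (a p) * freq p ^ t * exp (freq p * pt s)) = 0"
      using z that unfolding auxval_def pt_def by blast
    obtain g where "g holomorphic_on UNIV"
      "\<And>z. (\<Sum>p\<in>?J. of_int (a p) * exp (freq p * z)) = (z - pt s) ^ r * g z"
      "g (pt s) = (\<Sum>p\<in>?J. of_int (a p) * freq p ^ r * exp (freq p * pt s)) / fact r"
      using exp_sum_factor[of ?J r "\<lambda>p. of_int (a p)" freq, OF _ *] by blast
    then show ?thesis unfolding F_def auxval_def pt_def by blast
  qed
  then obtain g where g: "\<And>s. s < m \<Longrightarrow> g s holomorphic_on UNIV"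
    "\<And>s z. s < m \<Longrightarrow> F z = (z - pt s) ^ r * g s z"
    "\<And>s. s < m \<Longrightarrow> g s (pt s) = auxval q a r s / fact r" by metis
  define g' where "g' p = g (inv_into {..<m} pt p)" for p
  have g': "g' (pt s) = g s" if "s < m" for s
    unfolding g'_def using injpt that by simp
  have norm_pt: "cmod (pt s) \<le> K * real m" if "s < m" for s
    unfolding pt_def using norm_\<tau> that K1 by (auto simp: norm_mult intro!: mult_mono)
  have FB: "cmod (F z) \<le> real q ^ 2 * B * exp (2 * K * real r)" if "cmod z = R" for z
  proof -
    have "cmod (F z) \<le> (\<Sum>p\<in>?J. B * exp (2 * K * real r))"
      unfolding F_def
    proof (rule sum_norm_le)
      fix p assume p: "p \<in> ?J"
      have "cmod (exp (freq p * z)) \<le> exp (cmod (freq p * z))" by (rule norm_exp)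
      also have "cmod (freq p * z) \<le> 2 * real q * K * R"
        using norm_freq[OF p] that R by (simp add: norm_mult mult_right_mono)
      also have "2 * real q * K * R = 2 * K * real r" unfolding R_def using q by simp
      finally show "cmod (of_int (a p) * exp (freq p * z)) \<le> B * exp (2 * K * real r)"
        using a[OF p] B by (auto simp: norm_mult intro!: mult_mono)
    qed
    then show ?thesis by (simp add: card_cartesian_product power2_eq_square mult_ac)
  qed
  have "cmod (g' (pt s) (pt s)) \<le> real q ^ 2 * B * exp (2 * K * real r) * (2 / R) ^ (r * card P)
      * (\<Prod>q\<in>P - {pt s}. cmod (pt s - q) ^ r)"
  proof (rule zeros_bound[where F = F and g = g' and p = "pt s" and P = P and R = R])
    show "finite P" unfolding P_def by simp
    show "F holomorphic_on UNIV" unfolding F_def by (intro holomorphic_intros)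
    show "g' p holomorphic_on UNIV" if "p \<in> P" for p using that g(1) g' unfolding P_def by auto
    show "F z = (z - p) ^ r * g' p z" if "p \<in> P" for p z using that g(2) g' unfolding P_def by auto
    show "pt s \<in> P" unfolding P_def using s by simp
    show "0 < R" by (rule R)
    show "cmod p \<le> R / 2" if "p \<in> P" for p using that norm_pt R2 unfolding P_def by fastforce
  qed (rule FB)
  also have "(\<Prod>q\<in>P - {pt s}. cmod (pt s - q) ^ r) \<le> (K * real m) ^ (r * m)"
  proof -
    have "(\<Prod>q\<in>P - {pt s}. cmod (pt s - q) ^ r) \<le> (\<Prod>q\<in>P - {pt s}. (K * real m) ^ r)"
    proof (rule prod_mono)
      fix p assume "p \<in> P - {pt s}"
      then obtain s' where s': "p = pt s'" "s' < m" unfolding P_def by auto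
      have "cmod (pt s - p) = cmod \<tau> * \<bar>real s - real s'\<bar>"
        unfolding s' pt_def by (metis norm_mult norm_of_real of_real_diff of_real_of_nat_eq right_diff_distrib)
      also have "\<dots> \<le> K * real m" using norm_\<tau> K1 s s' by (intro mult_mono) auto
      finally show "0 \<le> cmod (pt s - p) ^ r \<and> cmod (pt s - p) ^ r \<le> (K * real m) ^ r"
        by (auto intro: power_mono)
    qed
    also have "\<dots> = (K * real m) ^ (r * card (P - {pt s}))" by (simp add: power_mult)
    also have "\<dots> \<le> (K * real m) ^ (r * m)"
      using Km cP by (intro power_increasing mult_le_mono) (auto simp: P_def intro!: order_trans[OF card_Diff1_le])
    finally show ?thesis .
  qed
  finally have "cmod (g' (pt s) (pt s)) \<le> real q ^ 2 * B * exp (2 * K * real r) * (2 / R) ^ (r * m) * (K * real m) ^ (r * m)"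
    using B R cP by (simp add: mult_left_mono)
  moreover have "cmod (g' (pt s) (pt s)) = cmod (auxval q a r s) / fact r"
    using g' g(3) s by (simp add: norm_divide)
  moreover have "2 / R = 2 * real q / real r" unfolding R_def using q by simp
  ultimately have "cmod (auxval q a r s) / fact r \<le> real q ^ 2 * B * exp (2 * K * real r)
     * (2 * real q / real r) ^ (r * m) * (K * real m) ^ (r * m)" by (simp only:)
  then show ?thesis by (subst (asm) pos_divide_le_eq) (simp_all add: mult.commute)
qed

end

section \<open>The contradiction between the two bounds\<close>

context exp_zspan
begin

text \<open>At the point \<open>s = 0\<close> all exponentials equal 1, and since the frequencies
  are distinct the derivatives there cannot all vanish. Hence a least order with a nonzero value
  exists.\<close>

lemma first_nonzero_auxval:
  assumes m: "0 < m" and a: "\<exists>p\<in>{..<q} \<times> {..<q}. a p \<noteq> 0"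
    and z: "\<And>t s. t < n \<Longrightarrow> s < m \<Longrightarrow> auxval q a t s = 0"
  obtains r s where "n \<le> r" "s < m" "auxval q a r s \<noteq> 0"
    "\<And>t s. t < r \<Longrightarrow> s < m \<Longrightarrow> auxval q a t s = 0"
proof -
  let ?Q = "\<lambda>t. \<exists>s<m. auxval q a t s \<noteq> 0"
  define r where "r = (LEAST t. ?Q t)"
  obtain p where p: "p \<in> {..<q} \<times> {..<q}" "a p \<noteq> 0" using a by blast
  have "\<exists>t. (\<Sum>p\<in>{..<q} \<times> {..<q}. of_int (a p) * freq p ^ t) \<noteq> 0"
    by (rule exp_sum_nonzero_derivative[OF _ _ p(1)]) (use p inj_freq in \<open>auto intro: inj_on_subset\<close>)
  then obtain t where "auxval q a t 0 \<noteq> 0" unfolding auxval_def by auto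
  then have "?Q t" using m by blast
  then have r: "?Q r" unfolding r_def by (rule LeastI)
  have lt: "auxval q a t s = 0" if "t < r" "s < m" for t s
    using not_less_Least[of t ?Q] that unfolding r_def by blast
  have "n \<le> r" using r z by (meson not_le)
  with r lt that show ?thesis by blast
qed

text \<open>With \<open>q\<^sup>2\<close> a constant multiple of \<open>n\<close> and \<open>r \<ge> n\<close> the first order of derivation that does not vanish at all
  points, the nonzero value is at least \<open>(C q\<^bsup>4D\<^esup>)\<^bsup>-r\<^esup>\<close>, whereas the maximum principle on the circle of radius
  \<open>r/q\<close> bounds it by \<open>(C r q (q/r)\<^sup>m)\<^sup>r\<close>. As \<open>q\<close> is of order at most \<open>\<surd>r\<close>, these are incompatible for
  \<open>m = 4D + 4\<close> and large \<open>r\<close>.\<close>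

lemma inconsistent: False
proof -
  define D where "D = card I"
  \<comment> \<open>Once \<open>q\<^sup>2 \<le> N * r\<close> is inserted, the square of the final
    quantity \<open>Y\<close> is of order \<open>r\<close> to the power
    \<open>4 * D + 3 - m\<close>; this is the least \<open>m\<close> with a negative
    exponent.\<close>
  define m where "m = 4 * D + 4"
  \<comment> \<open>For \<open>q = N * X\<close> and \<open>n = N * X\<^sup>2\<close> this gives
    \<open>q\<^sup>2 = N * n\<close>, so the count of unknowns against equations holds with
    equality.\<close>
  define N where "N = 2 * m * D"
  have D: "1 \<le> D" using finI i0 card_gt_0_iff[of I] unfolding D_def by fastforce
  have N: "1 \<le> N" unfolding N_def m_def using D by simp
  define a1 where "a1 = 16 * K ^ (2 * m + 1)"
  define a2 where "a2 = 8 * a1 * K ^ (2 * m + 1)"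
  define C where "C = K ^ (2 * m) * 4 * a1 * exp (2 * K) * 2 ^ m * (K * real m) ^ m
      * (8 * (real D)\<^sup>2) * a2 ^ (2 * D)"
  have K0: "0 < K" using K1 by simp
  have a10: "0 < a1" and a20: "0 < a2" unfolding a1_def a2_def using K0 by auto
  have C0: "0 \<le> C" unfolding C_def using K0 a10 a20 by simp
  \<comment> \<open>As \<open>r \<ge> n = q * X\<close>, the bound by \<open>2 * K * m\<close>
    places the points inside half the radius, and the last one contradicts the final estimate
    \<open>r \<le> C\<^sup>2 * N ^ (8 * D + 5)\<close>.\<close>
  obtain X :: nat where X: "max (max 1 (2 * K * real m)) (C\<^sup>2 * real N ^ (8 * D + 5)) < real X"
    using reals_Archimedean2 by blast
  define q where "q = N * X"
  define n where "n = N * X\<^sup>2"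
  have X1: "1 \<le> X" using X by simp
  have q1: "1 \<le> q" unfolding q_def using N X1 by simp
  have qn: "q\<^sup>2 = N * n" unfolding q_def n_def by (simp add: power2_eq_square)
  have nq: "n = q * X" unfolding q_def n_def by (simp add: power2_eq_square)
  obtain a where a: "\<And>p. p \<in> {..<q} \<times> {..<q} \<Longrightarrow> \<bar>real_of_int (a p)\<bar> \<le> 2 * real q ^ 2 * ((2 * real q * K) ^ n * K ^ (2 * q * m))"
    "\<exists>p\<in>{..<q} \<times> {..<q}. a p \<noteq> 0" "\<And>t s. t < n \<Longrightarrow> s < m \<Longrightarrow> auxval q a t s = 0"
    using auxiliary_function[of q m n] q1 qn unfolding N_def D_def by auto
  have m0: "0 < m" unfolding m_def by simp
  obtain r s where r: "n \<le> r" "s < m" "auxval q a r s \<noteq> 0"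
    "\<And>t s. t < r \<Longrightarrow> s < m \<Longrightarrow> auxval q a t s = 0"
    using first_nonzero_auxval[OF m0 a(2,3)] by blast
  have qr: "q \<le> r" using nq X1 r(1) by (metis le_trans mult.right_neutral mult_le_mono2)
  have r1: "1 \<le> r" using qr q1 by simp
  \<comment> \<open>The order \<open>n\<close> in the coefficient bound is raised to
    \<open>r\<close>, so that all estimates below can be written as \<open>r\<close>-th
    powers.\<close>
  define B where "B = 2 * real q ^ 2 * ((2 * real q * K) ^ r * K ^ (2 * q * m))"
  have qK: "1 \<le> 2 * real q * K" using q1 K1 mult_mono[of 1 "2 * real q" 1 K] by simp
  have H1: "1 \<le> (2 * real q * K) ^ r * K ^ (2 * q * m)"
    by (rule one_le_mult[OF one_le_power[OF qK] one_le_power[OF K1]])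
  have "1 \<le> real q ^ 2" using q1 by simp
  then have B1: "1 \<le> B" unfolding B_def using H1 mult_mono[of 1 "2 * real q ^ 2" 1 "(2 * real q * K) ^ r * K ^ (2 * q * m)"] by simp
  have aB: "\<bar>real_of_int (a p)\<bar> \<le> B" if "p \<in> {..<q} \<times> {..<q}" for p
  proof -
    have "(2 * real q * K) ^ n \<le> (2 * real q * K) ^ r" using r(1) qK by (rule power_increasing)
    then have "2 * real q ^ 2 * ((2 * real q * K) ^ n * K ^ (2 * q * m)) \<le> B"
      unfolding B_def using K0 by (intro mult_left_mono mult_right_mono) auto
    then show ?thesis using a(1)[OF that] by linarith
  qed
  have "2 * K * real m * real q \<le> real X * real q"
    using X by (intro mult_right_mono) auto
  also have "\<dots> = real n" using nq by simp
  also have "\<dots> \<le> real r" using r(1) by simp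
  finally have rR: "2 * K * real m * real q \<le> real r" .
  have up: "cmod (auxval q a r s) \<le> fact r * (real q ^ 2 * B * exp (2 * K * real r)
     * (2 * real q / real r) ^ (r * m) * (K * real m) ^ (r * m))"
    by (rule norm_auxval_le[OF r(4) r(2) aB B1 q1 rR])
  have lo: "1 \<le> K ^ (2 * q * m) * cmod (auxval q a r s) * (8 * (real D)\<^sup>2
     * (real q ^ 2 * B * ((2 * real q * K) ^ r * K ^ (2 * q * m))) ^ (2 * D))"
    unfolding D_def by (rule norm_auxval_ge[OF r(2,3) q1 B1 aB])
  have Kq: "K ^ (2 * q * m) \<le> (K ^ (2 * m)) ^ r"
    unfolding power_mult[symmetric] using qr K1 by (intro power_increasing) auto
  have q2: "real q ^ 2 \<le> 4 ^ r"
  proof -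
    have "real q \<le> 2 ^ r" using qr of_nat_less_two_power[of r, where 'a = real] by (simp add: order_trans[OF _ less_imp_le])
    then have "real q ^ 2 \<le> (2 ^ r)\<^sup>2" by (intro power_mono) auto
    also have "(2 ^ r)\<^sup>2 = (4::real) ^ r" by (simp add: power2_eq_square flip: power_mult_distrib)
    finally show ?thesis .
  qed
  have two: "(2::real) \<le> 2 ^ r" using r1 self_le_power[of "2::real" r] by simp
  have B: "B \<le> (a1 * real q) ^ r"
  proof -
    have "B \<le> 2 ^ r * 4 ^ r * ((2 * real q * K) ^ r * (K ^ (2 * m)) ^ r)"
      unfolding B_def using K0 by (intro mult_mono two q2 Kq order_refl) auto
    also have "\<dots> = (a1 * real q) ^ r"
      unfolding a1_def power_mult_distrib[symmetric] by (simp add: mult_ac)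
    finally show ?thesis .
  qed
  have S: "real q ^ 2 * B * ((2 * real q * K) ^ r * K ^ (2 * q * m)) \<le> (a2 * (real q)\<^sup>2) ^ r"
  proof -
    have "real q ^ 2 * B * ((2 * real q * K) ^ r * K ^ (2 * q * m))
       \<le> 4 ^ r * (a1 * real q) ^ r * ((2 * real q * K) ^ r * (K ^ (2 * m)) ^ r)"
      using K0 B1 a10 by (intro mult_mono q2 B Kq order_refl) auto
    also have "\<dots> = (a2 * (real q)\<^sup>2) ^ r"
      unfolding a2_def power_mult_distrib[symmetric] by (simp add: mult_ac power2_eq_square)
    finally show ?thesis .
  qed
  define Y where "Y = C * real r * real q ^ (4 * D + 1) * (real q / real r) ^ m"
  have D8: "8 * (real D)\<^sup>2 \<le> (8 * (real D)\<^sup>2) ^ r"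
  proof (rule self_le_power)
    have "1 \<le> (real D)\<^sup>2" using D by (intro one_le_power) simp
    then show "1 \<le> 8 * (real D)\<^sup>2" by simp
  qed (use r1 in simp)
  have "fact r * (real q ^ 2 * B * exp (2 * K * real r) * (2 * real q / real r) ^ (r * m) * (K * real m) ^ (r * m))
     \<le> real r ^ r * (4 ^ r * (a1 * real q) ^ r * exp (2 * K) ^ r * ((2 * real q / real r) ^ m) ^ r * ((K * real m) ^ m) ^ r)"
  proof -
    have e: "exp (2 * K * real r) = exp (2 * K) ^ r" "(2 * real q / real r) ^ (r * m) = ((2 * real q / real r) ^ m) ^ r"
       "(K * real m) ^ (r * m) = ((K * real m) ^ m) ^ r"
      by (simp_all add: exp_of_nat2_mult[symmetric] mult.commute flip: power_mult)
    have fr: "fact r \<le> real r ^ r" using fact_le_power[of r, where 'a = real] by simp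
    show ?thesis unfolding e
      using K0 B1 a10 by (intro mult_mono fr q2 B order_refl) auto
  qed
  with up have up': "cmod (auxval q a r s) \<le> real r ^ r * (4 ^ r * (a1 * real q) ^ r * exp (2 * K) ^ r * ((2 * real q / real r) ^ m) ^ r * ((K * real m) ^ m) ^ r)"
    by (rule order_trans)
  have "1 \<le> (K ^ (2 * m)) ^ r * (real r ^ r * (4 ^ r * (a1 * real q) ^ r * exp (2 * K) ^ r * ((2 * real q / real r) ^ m) ^ r * ((K * real m) ^ m) ^ r))
      * ((8 * (real D)\<^sup>2) ^ r * ((a2 * (real q)\<^sup>2) ^ r) ^ (2 * D))"
    by (rule order_trans[OF lo], intro mult_mono power_mono Kq up' D8 S) (use K0 B1 a10 a20 in auto)
  also have "\<dots> = Y ^ r"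
  proof -
    define Z where "Z = (K ^ (2 * m)) * (real r * (4 * (a1 * real q) * exp (2 * K) * ((2 * real q / real r) ^ m) * ((K * real m) ^ m)))
      * ((8 * (real D)\<^sup>2) * ((a2 * (real q)\<^sup>2) ^ (2 * D)))"
    have "((a2 * (real q)\<^sup>2) ^ r) ^ (2 * D) = ((a2 * (real q)\<^sup>2) ^ (2 * D)) ^ r"
      by (simp add: mult.commute flip: power_mult)
    then have "(K ^ (2 * m)) ^ r * (real r ^ r * (4 ^ r * (a1 * real q) ^ r * exp (2 * K) ^ r * ((2 * real q / real r) ^ m) ^ r * ((K * real m) ^ m) ^ r))
      * ((8 * (real D)\<^sup>2) ^ r * ((a2 * (real q)\<^sup>2) ^ r) ^ (2 * D)) = Z ^ r"
      unfolding Z_def by (simp only: power_mult_distrib[of _ _ r])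
    moreover have "Z = Y"
    proof -
      have e: "(a2 * (real q)\<^sup>2) ^ (2 * D) = a2 ^ (2 * D) * real q ^ (4 * D)"
        by (simp add: power_mult_distrib flip: power_mult)
      have e': "(2 * real q / real r) ^ m = 2 ^ m * (real q / real r) ^ m"
        by (simp flip: power_mult_distrib)
      show ?thesis unfolding Z_def Y_def C_def e e' power_add power_one_right by (simp only: mult_ac)
    qed
    ultimately show ?thesis by simp
  qed
  finally have Y1: "1 \<le> Y ^ r" .
  have Y0: "0 \<le> Y" unfolding Y_def using C0 by simp
  have "1 \<le> Y" using Y1 Y0 r1 by (metis not_le power_strict_mono power_one zero_less_iff_neq_zero not_one_le_zero)
  \<comment> \<open>Squaring makes \<open>q\<^sup>2 \<le> N * r\<close> applicable without square
    roots.\<close>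
  then have "1 \<le> Y\<^sup>2" by (rule one_le_power)
  also have "Y\<^sup>2 = C\<^sup>2 * (real r)\<^sup>2 * (real q ^ 2) ^ (8 * D + 5) / real r ^ (8 * D + 8)"
  proof -
    have "(real q ^ (4 * D + 1) * real q ^ m)\<^sup>2 = (real q ^ 2) ^ (8 * D + 5)"
      unfolding m_def power_mult[symmetric] power_add[symmetric] by (simp add: algebra_simps)
    moreover have "(real r ^ m)\<^sup>2 = real r ^ (8 * D + 8)"
      unfolding m_def power_mult[symmetric] by (simp add: algebra_simps)
    ultimately show ?thesis unfolding Y_def by (simp add: power_mult_distrib power_divide)
  qed
  also have "\<dots> \<le> C\<^sup>2 * (real r)\<^sup>2 * (real N * real r) ^ (8 * D + 5) / real r ^ (8 * D + 8)"
  proof -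
    have "real q ^ 2 = real N * real n" using arg_cong[OF qn, of real] by simp
    then have "real q ^ 2 \<le> real N * real r" using r(1) by (simp add: mult_left_mono)
    then show ?thesis by (intro divide_right_mono mult_left_mono power_mono) auto
  qed
  also have "\<dots> = C\<^sup>2 * real N ^ (8 * D + 5) / real r"
  proof -
    have "real r ^ (8 * D + 8) = (real r)\<^sup>2 * real r ^ (8 * D + 5) * real r"
      by (simp add: power2_eq_square eval_nat_numeral)
    then show ?thesis using r1 by (simp add: power_mult_distrib)
  qed
  finally have "real r \<le> C\<^sup>2 * real N ^ (8 * D + 5)" using r1 by (simp add: divide_simps)
  also have "\<dots> < real X" using X by simp
  also have "real X \<le> real r"
  proof -
    have "X \<le> n" using nq q1 by simp
    then show ?thesis using r(1) by simp
  qed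
  finally show False by simp
qed

end

text \<open>The symmetric form of the theorem: for \<open>x \<noteq> 0\<close>, put
  \<open>\<alpha> = exp (t * x)\<close> and \<open>\<beta> = y / x\<close>; then
  \<open>exp (t * y)\<close> is a value of \<alpha> to the power \<beta>. The nonzero number
  \<open>t\<close> may be transcendental, which is what an unknown time requires.\<close>

lemma (in zspan) gelfond_schneider:
  assumes x: "rep x Hx" and y: "rep y Hy" and u: "rep u Hu" and v: "rep v Hv"
    and M: "M \<noteq> 0" "of_int M * exp (t * x) = u" "of_int M * exp (t * y) = v" and t: "t \<noteq> 0"
  shows "\<exists>a b :: int. (a \<noteq> 0 \<or> b \<noteq> 0) \<and> of_int a * x + of_int b * y = 0"
proof (rule ccontr)
  assume neg: "\<not> ?thesis"
  define K where "K = 1 + Hx + Hy + Hu + Hv + \<bar>of_int M\<bar> + cmod x + cmod y + cmod t"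
  note nn = rep_nonneg[OF x] rep_nonneg[OF y] rep_nonneg[OF u] rep_nonneg[OF v]
  interpret exp_zspan I \<omega> i0 x y t u v M K
  proof
    show "rep x K" "rep y K" "rep u K" "rep v K"
      using nn by (auto simp: K_def intro!: rep_mono[OF x] rep_mono[OF y] rep_mono[OF u] rep_mono[OF v])
    show "1 \<le> K" "\<bar>of_int M\<bar> \<le> K" "cmod x \<le> K" "cmod y \<le> K" "cmod t \<le> K"
      unfolding K_def using nn by auto
    show "a = 0 \<and> b = 0" if "of_int a * x + of_int b * y = 0" for a b :: int
      using neg that by blast
  qed (use M t in auto)
  show False by (rule inconsistent)
qed

section \<open>Rational linear algebra\<close>

text \<open>A basis of \<open>span S\<close> stays independent when \<open>x\<close> is added, so
  the values 0 on the basis and 1 at \<open>x\<close> extend linearly.\<close>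

lemma (in vector_space) exists_functional:
  assumes "x \<notin> span S"
  obtains \<phi> :: "'b \<Rightarrow> 'a" where "\<And>y z. \<phi> (y + z) = \<phi> y + \<phi> z" "\<And>c y. \<phi> (c *s y) = c * \<phi> y"
    "\<And>y. y \<in> S \<Longrightarrow> \<phi> y = 0" "\<phi> x = 1"
proof -
  interpret S: vector_space "(*) :: 'a \<Rightarrow> 'a \<Rightarrow> 'a"
    by unfold_locales (simp_all add: algebra_simps)
  interpret P: vector_space_pair scale "(*) :: 'a \<Rightarrow> 'a \<Rightarrow> 'a" ..
  obtain B where B: "B \<subseteq> S" "independent B" "S \<subseteq> span B"
    using maximal_independent_subset[of S] by blast
  have x: "x \<notin> span B" using assms B(1) span_mono by blast
  then have "independent (insert x B)" using B(2) by (simp add: independent_insertI)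
  from P.linear_independent_extend[OF this, of "\<lambda>y. if y = x then 1 else 0"]
  obtain \<phi> where \<phi>: "Vector_Spaces.linear scale (*) \<phi>" "\<And>y. y \<in> insert x B \<Longrightarrow> \<phi> y = (if y = x then 1 else 0)"
    by blast
  have "x \<notin> B" using x span_base by blast
  then have "\<And>y. y \<in> B \<Longrightarrow> \<phi> y = 0" using \<phi>(2) by auto
  then have "\<And>y. y \<in> S \<Longrightarrow> \<phi> y = 0" using P.linear_eq_0_on_span[OF \<phi>(1)] B(3) by blast
  then show ?thesis using that[of \<phi>] \<phi> P.linear_add[OF \<phi>(1)] P.linear_scale[OF \<phi>(1)] by auto
qed

text \<open>The linear functional on polynomials that sends the \<open>i\<close>-th power of the
  variable to \<open>f i\<close>. If \<open>f i\<close> is an entry of \<open>A^i e_u\<close>, the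
  result is that entry of \<open>p(A) e_u\<close>.\<close>

definition lin_eval :: "'c::comm_ring_1 poly \<Rightarrow> (nat \<Rightarrow> 'c) \<Rightarrow> 'c" where
  "lin_eval p f = (\<Sum>i\<le>Polynomial.degree p. coeff p i * f i)"

lemma lin_eval_lessThan: "lin_eval p f = (\<Sum>i<K. coeff p i * f i)" if "Polynomial.degree p < K"
  unfolding lin_eval_def using that coeff_eq_0[of p]
  by (intro sum.mono_neutral_left) auto

lemma lin_eval_0 [simp]: "lin_eval 0 f = 0"
  by (simp add: lin_eval_def)

lemma lin_eval_add: "lin_eval (p + q) f = lin_eval p f + lin_eval q f"
proof -
  define K where "K = Suc (max (Polynomial.degree p) (Polynomial.degree q))"
  have "Polynomial.degree p < K" "Polynomial.degree q < K" "Polynomial.degree (p + q) < K"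
    unfolding K_def using degree_add_le_max[of p q] by (auto simp: less_Suc_eq_le)
  then show ?thesis by (simp add: lin_eval_lessThan sum.distrib algebra_simps)
qed

lemma lin_eval_smult: "lin_eval (smult c p) f = c * lin_eval p f"
proof -
  have "Polynomial.degree (smult c p) < Suc (Polynomial.degree p)"
    using degree_smult_le[of c p] by simp
  then show ?thesis
    by (simp add: lin_eval_lessThan[of _ "Suc (Polynomial.degree p)"] sum_distrib_left mult_ac del: sum.lessThan_Suc)
qed

lemma lin_eval_diff: "lin_eval (p - q) f = lin_eval p f - lin_eval q f"
  using lin_eval_add[of p "- q" f] lin_eval_smult[of "- 1" q f] by simp

lemma lin_eval_pCons_0: "lin_eval (pCons 0 p) f = lin_eval p (\<lambda>i. f (Suc i))"
proof -
  have "Polynomial.degree (pCons 0 p) < Suc (Suc (Polynomial.degree p))"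
    using degree_pCons_le[of 0 p] by simp
  then show ?thesis
    by (simp add: lin_eval_lessThan[of "pCons 0 p" "Suc (Suc (Polynomial.degree p))"]
      lin_eval_lessThan[of p "Suc (Polynomial.degree p)"] sum.lessThan_Suc_shift del: sum.lessThan_Suc)
qed

lemma lin_eval_monom: "lin_eval (monom c j) f = c * f j"
  by (subst lin_eval_lessThan[of _ "Suc j"])
     (simp_all add: degree_monom_le less_Suc_eq_le)

lemma lin_eval_sum_right: "(\<Sum>v\<in>V. y v * lin_eval p (\<lambda>i. f i v)) = lin_eval p (\<lambda>i. \<Sum>v\<in>V. y v * f i v)"
  unfolding lin_eval_def sum_distrib_left by (subst sum.swap) (simp add: mult_ac)

lemma lin_eval_mult_right: "lin_eval p (\<lambda>i. f i * c) = lin_eval p f * c"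
  unfolding lin_eval_def by (simp add: sum_distrib_right mult.assoc)

lemma lin_eval_power: "lin_eval p (\<lambda>i. x ^ i) = poly p x"
  unfolding lin_eval_def poly_altdef ..

lemma lin_eval_of_int: "lin_eval (map_poly of_int p) (\<lambda>i. of_int (f i)) = (of_int (lin_eval p f) :: 'c :: {comm_ring_1, ring_char_0})"
  unfolding lin_eval_def by (simp add: coeff_map_poly degree_map_poly)

text \<open>Double orthogonality over the rationals: a vector outside the span is separated from it
  by a functional, which on vectors supported on \<open>V\<close> is the dot product with some
  \<open>y\<close>. Clearing denominators produces \<open>N\<close>; as \<open>T\<close> may be
  infinite, the finitely many coefficients are stored in a polynomial.\<close>

lemma int_vector_in_span:
  fixes b :: "nat \<Rightarrow> 'a \<Rightarrow> int" and s :: "'a \<Rightarrow> int"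
  assumes fin: "finite V"
    and dual: "\<And>y :: 'a \<Rightarrow> rat. (\<And>j. j \<in> T \<Longrightarrow> (\<Sum>v\<in>V. y v * of_int (b j v)) = 0) \<Longrightarrow> (\<Sum>v\<in>V. y v * of_int (s v)) = 0"
  obtains p N where "N \<noteq> 0" "\<And>i. coeff p i \<noteq> 0 \<Longrightarrow> i \<in> T"
    "\<And>v. v \<in> V \<Longrightarrow> N * s v = lin_eval p (\<lambda>i. b i v)"
proof -
  define r where "r f = (\<lambda>v. if v \<in> V then rat_of_int (f v) else 0)" for f :: "'a \<Rightarrow> int"
  interpret vector_space "\<lambda>(c::rat) (f::'a \<Rightarrow> rat) x. c * f x"
    by unfold_locales (auto simp: algebra_simps)
  have "r s \<in> span ((\<lambda>j. r (b j)) ` T)"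
  proof (rule ccontr)
    assume "\<not> ?thesis"
    then obtain \<phi> :: "('a \<Rightarrow> rat) \<Rightarrow> rat" where \<phi>: "\<And>y z. \<phi> (y + z) = \<phi> y + \<phi> z"
      "\<And>c y. \<phi> (\<lambda>x. c * y x) = c * \<phi> y" "\<And>y. y \<in> (\<lambda>j. r (b j)) ` T \<Longrightarrow> \<phi> y = 0" "\<phi> (r s) = 1"
      by (rule exists_functional[of "r s" "(\<lambda>j. r (b j)) ` T"]) blast
    have \<phi>r: "\<phi> (\<lambda>v. if v \<in> W then rat_of_int (f v) else 0) = (\<Sum>v\<in>W. \<phi> (\<lambda>x. if x = v then 1 else 0) * of_int (f v))"
      if "finite W" for f W using that
    proof (induction rule: finite_induct)
      case empty
      show ?case using \<phi>(2)[of 0 "\<lambda>_. 0"] by simp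
    next
      case (insert z W)
      have "(\<lambda>v. if v \<in> insert z W then rat_of_int (f v) else 0)
         = (\<lambda>x. of_int (f z) * (if x = z then 1 else 0)) + (\<lambda>v. if v \<in> W then rat_of_int (f v) else 0)"
        using insert by (auto simp: fun_eq_iff)
      then show ?case using insert \<phi>(2)[of "of_int (f z)" "\<lambda>x. if x = z then 1 else 0"] by (simp add: \<phi>(1) mult.commute)
    qed
    have "(\<Sum>v\<in>V. \<phi> (\<lambda>x. if x = v then 1 else 0) * of_int (s v)) = 0"
    proof (rule dual)
      fix j assume "j \<in> T"
      then have "\<phi> (r (b j)) = 0" using \<phi>(3) by blast
      then show "(\<Sum>v\<in>V. \<phi> (\<lambda>x. if x = v then 1 else 0) * of_int (b j v)) = 0"
        using \<phi>r[OF fin, of "b j"] by (simp add: r_def)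
    qed
    then show False using \<phi>(4) \<phi>r[OF fin, of s] by (simp add: r_def)
  qed
  then have "\<exists>N p. N \<noteq> 0 \<and> (\<forall>i. coeff p i \<noteq> 0 \<longrightarrow> i \<in> T) \<and> (\<forall>v\<in>V. of_int N * r s v = of_int (lin_eval p (\<lambda>i. b i v)))"
  proof (induction rule: span_induct_alt)
    case base
    show ?case by (rule exI[of _ 1], rule exI[of _ 0]) auto
  next
    case (step c x y)
    then obtain j where j: "j \<in> T" "x = r (b j)" by blast
    obtain N p where Np: "N \<noteq> 0" "\<forall>i. coeff p i \<noteq> 0 \<longrightarrow> i \<in> T" "\<forall>v\<in>V. of_int N * y v = of_int (lin_eval p (\<lambda>i. b i v))"
      using step.IH by blast
    obtain m k where mk: "c = of_int m / of_int k" "k > 0" by (metis quotient_of_div quotient_of_denom_pos surj_pair)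
    show ?case
    proof (rule exI[of _ "N * k"], rule exI[of _ "smult k p + monom (N * m) j"], intro conjI allI impI ballI)
      show "N * k \<noteq> 0" using Np mk by simp
      show "i \<in> T" if "coeff (smult k p + monom (N * m) j) i \<noteq> 0" for i
        using that Np(2) j(1) by (cases "i = j") auto
      fix v assume v: "v \<in> V"
      have "of_int (N * k) * ((\<lambda>x'. c * x x') + y) v = of_int N * of_int m * r (b j) v + of_int k * (of_int N * y v)"
        using mk j by (simp add: field_simps)
      also have "\<dots> = of_int (lin_eval (smult k p + monom (N * m) j) (\<lambda>i. b i v))"
        using v Np(3) by (simp add: lin_eval_add lin_eval_smult lin_eval_monom r_def)
      finally show "of_int (N * k) * ((\<lambda>x'. c * x x') + y) v = of_int (lin_eval (smult k p + monom (N * m) j) (\<lambda>i. b i v))" .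
    qed
  qed
  then obtain N p where "N \<noteq> 0" "\<And>i. coeff p i \<noteq> 0 \<Longrightarrow> i \<in> T" "\<And>v. v \<in> V \<Longrightarrow> rat_of_int N * r s v = of_int (lin_eval p (\<lambda>i. b i v))"
    by blast
  moreover have "N * s v = lin_eval p (\<lambda>i. b i v)" if "v \<in> V" for v
  proof -
    have "rat_of_int (N * s v) = of_int (lin_eval p (\<lambda>i. b i v))" using calculation(3)[OF that] that by (simp add: r_def)
    then show ?thesis by (simp only: of_int_eq_iff)
  qed
  ultimately show ?thesis using that by blast
qed

section \<open>The minimal polynomial of a vertex\<close>

locale krylov =
  fixes V :: "'a set" and A :: "'a \<Rightarrow> 'a \<Rightarrow> int" and u :: 'a
  assumes finV: "finite V" and uV: "u \<in> V" and symA: "\<And>x y. A x y = A y x"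
begin

text \<open>The vector \<open>A^j e_u\<close>; its entry at \<open>v\<close> is the total weight of
  the walks of length \<open>j\<close> between \<open>u\<close> and \<open>v\<close>.\<close>

fun krylov_vec :: "nat \<Rightarrow> 'a \<Rightarrow> int" where
  "krylov_vec 0 v = (if v = u then 1 else 0)"
| "krylov_vec (Suc j) v = (\<Sum>x\<in>V. A v x * krylov_vec j x)"

text \<open>The vector \<open>p(A) e_u\<close>, with complex coefficients because
  \<open>minpol\<close> will be divided by linear factors.\<close>

definition kvec :: "complex poly \<Rightarrow> 'a \<Rightarrow> complex" where
  "kvec p v = lin_eval p (\<lambda>i. of_int (krylov_vec i v))"

definition annihilates :: "int poly \<Rightarrow> bool" where
  "annihilates p \<longleftrightarrow> p \<noteq> 0 \<and> (\<forall>v\<in>V. lin_eval p (\<lambda>i. krylov_vec i v) = 0)"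

text \<open>Siegel's lemma serves merely as a source of integer relations between the vectors
  \<open>A^j e_u\<close>; taking twice as many vectors as coordinates meets its hypothesis.\<close>

lemma ex_annihilates: "\<exists>p. annihilates p"
proof -
  let ?J = "{..<2 * card V}"
  define H where "H = 1 + (\<Sum>v\<in>V. \<Sum>j\<in>?J. \<bar>real_of_int (krylov_vec j v)\<bar>)"
  have H1: "1 \<le> H" unfolding H_def by (simp add: sum_nonneg)
  have H: "\<bar>real_of_int (krylov_vec j v)\<bar> \<le> H" if "v \<in> V" "j \<in> ?J" for v j
  proof -
    have "\<bar>real_of_int (krylov_vec j v)\<bar> \<le> (\<Sum>j\<in>?J. \<bar>real_of_int (krylov_vec j v)\<bar>)"
      using that by (intro member_le_sum) auto
    also have "\<dots> \<le> (\<Sum>v\<in>V. \<Sum>j\<in>?J. \<bar>real_of_int (krylov_vec j v)\<bar>)"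
      using that finV by (intro member_le_sum[of v V "\<lambda>v. \<Sum>j\<in>?J. \<bar>real_of_int (krylov_vec j v)\<bar>"]) (auto intro: sum_nonneg)
    finally show ?thesis unfolding H_def by simp
  qed
  have ne: "?J \<noteq> {}" using uV finV by (auto simp: lessThan_empty_iff)
  obtain a where a: "\<exists>j\<in>?J. a j \<noteq> 0" "\<And>v. v \<in> V \<Longrightarrow> (\<Sum>j\<in>?J. krylov_vec j v * a j) = 0"
    by (rule siegel[of V ?J H "\<lambda>v j. krylov_vec j v", OF finV finite_lessThan ne _ H1 H]) auto
  define p where "p = (\<Sum>j\<in>?J. monom (a j) j)"
  have c: "coeff p i = (if i < 2 * card V then a i else 0)" for i
    unfolding p_def by (simp add: coeff_sum)
  have "p \<noteq> 0" using a(1) c by (metis lessThan_iff coeff_0)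
  moreover have "lin_eval p (\<lambda>i. krylov_vec i v) = 0" if "v \<in> V" for v
  proof -
    have d: "Polynomial.degree p < 2 * card V"
      using ne c \<open>p \<noteq> 0\<close> by (metis leading_coeff_0_iff)
    show ?thesis using a(2)[OF that] c by (simp add: lin_eval_lessThan[OF d] mult.commute)
  qed
  ultimately show ?thesis unfolding annihilates_def by blast
qed

text \<open>Only the degree is minimised, so \<open>minpol\<close> need not be monic.\<close>

definition minpol :: "int poly" where
  "minpol = (ARG_MIN Polynomial.degree p. annihilates p)"

abbreviation mdeg :: nat where "mdeg \<equiv> Polynomial.degree minpol"

lemma annihilates_minpol: "annihilates minpol"
  and dim_le: "annihilates p \<Longrightarrow> mdeg \<le> Polynomial.degree p"
  unfolding minpol_def using ex_annihilates by (auto intro: arg_min_natI arg_min_nat_le)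

lemma minpol_nz: "minpol \<noteq> 0"
  using annihilates_minpol by (simp add: annihilates_def)

lemma map_poly_minpol_nz: "map_poly of_int minpol \<noteq> (0 :: complex poly)"
  using minpol_nz by (auto simp: poly_eq_iff coeff_map_poly)

text \<open>Minimality of \<open>mdeg\<close> is a statement about integer polynomials and must be
  carried over to complex ones. A rational \<open>y\<close> orthogonal to all \<open>A^i e_u\<close>
  with \<open>i < mdeg\<close> except the \<open>j\<close>-th isolates the coefficient of index
  \<open>j\<close>.\<close>

lemma kvec_independent:
  assumes deg: "Polynomial.degree p < mdeg" and p: "\<And>v. v \<in> V \<Longrightarrow> kvec p v = 0"
  shows "p = 0"
proof (rule ccontr)
  assume "p \<noteq> 0"
  then obtain j where j: "coeff p j \<noteq> 0" by (metis leading_coeff_0_iff)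
  have jd: "j < mdeg" using j deg le_degree[of p j] by simp
  let ?T = "{i. i < mdeg \<and> i \<noteq> j}"
  have "\<exists>y :: 'a \<Rightarrow> rat. (\<forall>i\<in>?T. (\<Sum>v\<in>V. y v * of_int (krylov_vec i v)) = 0) \<and> (\<Sum>v\<in>V. y v * of_int (krylov_vec j v)) \<noteq> 0"
  proof (rule ccontr)
    assume neg: "\<not> ?thesis"
    have dual: "(\<Sum>v\<in>V. y v * of_int (krylov_vec j v)) = 0"
      if "\<And>i. i \<in> ?T \<Longrightarrow> (\<Sum>v\<in>V. y v * of_int (krylov_vec i v)) = 0" for y :: "'a \<Rightarrow> rat"
      using neg that by blast
    obtain q N where q: "N \<noteq> 0" "\<And>i. coeff q i \<noteq> 0 \<Longrightarrow> i \<in> ?T"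
      "\<And>v. v \<in> V \<Longrightarrow> N * krylov_vec j v = lin_eval q (\<lambda>i. krylov_vec i v)"
      by (rule int_vector_in_span[of V ?T krylov_vec "krylov_vec j", OF finV dual]) blast+
    let ?r = "monom N j - q"
    have "coeff ?r j = N" using q(2)[of j] by auto
    then have "?r \<noteq> 0" using q(1) by auto
    moreover have "lin_eval ?r (\<lambda>i. krylov_vec i v) = 0" if "v \<in> V" for v
      using q(3)[OF that] by (simp add: lin_eval_diff lin_eval_monom)
    ultimately have "annihilates ?r" unfolding annihilates_def by blast
    then have "mdeg \<le> Polynomial.degree ?r" by (rule dim_le)
    moreover have "Polynomial.degree ?r < mdeg"
    proof -
      have "coeff ?r i = 0" if "mdeg \<le> i" for i using q(2)[of i] that jd by auto
      then show ?thesis using \<open>?r \<noteq> 0\<close> by (metis leading_coeff_0_iff not_le)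
    qed
    ultimately show False by simp
  qed
  then obtain y :: "'a \<Rightarrow> rat" where y: "\<And>i. i \<in> ?T \<Longrightarrow> (\<Sum>v\<in>V. y v * of_int (krylov_vec i v)) = 0"
    "(\<Sum>v\<in>V. y v * of_int (krylov_vec j v)) \<noteq> 0" by blast
  define Y :: "nat \<Rightarrow> complex" where "Y i = (\<Sum>v\<in>V. of_rat (y v) * of_int (krylov_vec i v))" for i
  have Y: "Y i = of_rat (\<Sum>v\<in>V. y v * of_int (krylov_vec i v))" for i
    unfolding Y_def by (simp add: of_rat_sum of_rat_mult)
  have "0 = (\<Sum>v\<in>V. of_rat (y v) * kvec p v)" using p by simp
  also have "\<dots> = lin_eval p Y" unfolding kvec_def Y_def by (rule lin_eval_sum_right)
  also have "\<dots> = (\<Sum>i<mdeg. coeff p i * Y i)" using deg by (rule lin_eval_lessThan)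
  also have "\<dots> = (\<Sum>i\<in>{j}. coeff p i * Y i)"
    using jd y(1) Y by (intro sum.mono_neutral_right) auto
  finally show False using j y(2) Y by simp
qed

lemma kvec_diff: "kvec (p - q) v = kvec p v - kvec q v"
  and kvec_smult: "kvec (smult c p) v = c * kvec p v"
  by (simp_all add: kvec_def lin_eval_diff lin_eval_smult)

lemma kvec_pCons_0: "kvec (pCons 0 p) v = (\<Sum>x\<in>V. of_int (A v x) * kvec p x)"
  unfolding kvec_def lin_eval_pCons_0 lin_eval_sum_right by simp

lemma kvec_linear_factor: "kvec ([:- \<rho>, 1:] * p) v = (\<Sum>x\<in>V. of_int (A v x) * kvec p x) - \<rho> * kvec p v"
proof -
  have "[:- \<rho>, 1:] * p = pCons 0 p - smult \<rho> p" by simp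
  then show ?thesis by (simp add: kvec_diff kvec_smult kvec_pCons_0)
qed

lemma kvec_minpol: "v \<in> V \<Longrightarrow> kvec (map_poly of_int minpol) v = 0"
  using annihilates_minpol unfolding kvec_def annihilates_def by (simp add: lin_eval_of_int)

section \<open>Eigenvectors and the roots of the minimal polynomial\<close>

definition is_eigvec :: "complex \<Rightarrow> ('a \<Rightarrow> complex) \<Rightarrow> bool" where
  "is_eigvec \<rho> w \<longleftrightarrow> (\<forall>v\<in>V. (\<Sum>x\<in>V. of_int (A v x) * w x) = \<rho> * w v)"

text \<open>The pairing is bilinear, without conjugation, so symmetry of \<open>A\<close> moves each
  factor \<open>A\<close> onto \<open>w\<close>.\<close>

lemma eigvec_adjoint:
  assumes "is_eigvec \<rho> w"
  shows "(\<Sum>v\<in>V. w v * of_int (krylov_vec j v)) = \<rho> ^ j * w u"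
proof (induction j)
  case 0
  have "(\<Sum>v\<in>V. w v * of_int (krylov_vec 0 v)) = (\<Sum>v\<in>V. if v = u then w v else 0)"
    by (intro sum.cong) auto
  then show ?case using finV uV by simp
next
  case (Suc j)
  have "(\<Sum>v\<in>V. w v * of_int (krylov_vec (Suc j) v)) = (\<Sum>v\<in>V. \<Sum>x\<in>V. of_int (A v x) * w v * of_int (krylov_vec j x))"
    by (simp add: sum_distrib_left mult_ac)
  also have "\<dots> = (\<Sum>x\<in>V. (\<Sum>v\<in>V. of_int (A x v) * w v) * of_int (krylov_vec j x))"
    unfolding sum_distrib_right by (subst sum.swap) (intro sum.cong refl, metis symA)
  also have "\<dots> = (\<Sum>x\<in>V. \<rho> * (w x * of_int (krylov_vec j x)))"
    using assms unfolding is_eigvec_def by (simp add: mult.assoc)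
  also have "\<dots> = \<rho> * (\<rho> ^ j * w u)" using Suc by (simp flip: sum_distrib_left)
  finally show ?case by simp
qed

lemma self_adjoint:
  "(\<Sum>v\<in>V. cnj (f v) * (\<Sum>x\<in>V. of_int (A v x) * g x)) = (\<Sum>v\<in>V. cnj (\<Sum>x\<in>V. of_int (A v x) * f x) * g v)"
proof -
  have "(\<Sum>v\<in>V. cnj (f v) * (\<Sum>x\<in>V. of_int (A v x) * g x)) = (\<Sum>v\<in>V. \<Sum>x\<in>V. cnj (f v) * of_int (A v x) * g x)"
    by (simp add: sum_distrib_left mult_ac)
  also have "\<dots> = (\<Sum>x\<in>V. \<Sum>v\<in>V. cnj (f v) * of_int (A v x) * g x)" by (rule sum.swap)
  also have "\<dots> = (\<Sum>v\<in>V. cnj (\<Sum>x\<in>V. of_int (A v x) * f x) * g v)"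
  proof (intro sum.cong refl)
    fix x
    show "(\<Sum>v\<in>V. cnj (f v) * of_int (A v x) * g x) = cnj (\<Sum>v\<in>V. of_int (A x v) * f v) * g x"
      unfolding cnj_sum sum_distrib_right by (intro sum.cong refl) (simp add: symA[of _ x])
  qed
  finally show ?thesis .
qed

lemma sum_cnj_self_eq_0:
  assumes "(\<Sum>v\<in>V. cnj (w v) * w v) = 0" "v \<in> V"
  shows "w v = 0"
proof -
  have "(\<Sum>v\<in>V. cnj (w v) * w v) = of_real (\<Sum>v\<in>V. (cmod (w v))\<^sup>2)"
    unfolding of_real_sum by (intro sum.cong refl) (simp only: complex_norm_square mult.commute)
  then have "(\<Sum>v\<in>V. (cmod (w v))\<^sup>2) = 0" using assms(1) by (metis of_real_eq_0_iff)
  then show ?thesis using assms(2) finV by (simp add: sum_nonneg_eq_0_iff)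
qed

lemma eigvec_real:
  assumes e: "is_eigvec \<rho> w" and v: "v \<in> V" "w v \<noteq> 0"
  shows "\<rho> \<in> \<real>"
proof -
  have "(\<Sum>v\<in>V. cnj (w v) * (\<Sum>x\<in>V. of_int (A v x) * w x)) = \<rho> * (\<Sum>v\<in>V. cnj (w v) * w v)"
    using e unfolding is_eigvec_def by (simp add: sum_distrib_left mult_ac)
  moreover have "(\<Sum>v\<in>V. cnj (\<Sum>x\<in>V. of_int (A v x) * w x) * w v) = cnj \<rho> * (\<Sum>v\<in>V. cnj (w v) * w v)"
    using e unfolding is_eigvec_def sum_distrib_left by (intro sum.cong refl) simp
  moreover have "(\<Sum>v\<in>V. cnj (w v) * w v) \<noteq> 0" using sum_cnj_self_eq_0 v by blast
  ultimately have "\<rho> = cnj \<rho>" using self_adjoint[of w w] by simp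
  then show ?thesis by (simp add: Reals_cnj_iff)
qed

text \<open>Compare both sides of the eigenvalue equation at an entry of largest modulus.\<close>

lemma eigvec_norm_le:
  assumes e: "is_eigvec \<rho> w" and v: "v \<in> V" "w v \<noteq> 0"
    and k: "\<And>v. v \<in> V \<Longrightarrow> (\<Sum>x\<in>V. \<bar>real_of_int (A v x)\<bar>) \<le> k"
  shows "cmod \<rho> \<le> k"
proof -
  obtain z where z: "z \<in> V" "\<And>x. x \<in> V \<Longrightarrow> cmod (w x) \<le> cmod (w z)"
  proof -
    have "Max ((\<lambda>x. cmod (w x)) ` V) \<in> (\<lambda>x. cmod (w x)) ` V" using finV v(1) by (intro Max_in) auto
    then obtain z where z: "z \<in> V" "Max ((\<lambda>x. cmod (w x)) ` V) = cmod (w z)" by auto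
    have "cmod (w x) \<le> Max ((\<lambda>x. cmod (w x)) ` V)" if "x \<in> V" for x using finV that by simp
    then show thesis using that z by simp
  qed
  have pos: "0 < cmod (w z)" using z(2)[OF v(1)] v(2) by (meson less_le_trans zero_less_norm_iff)
  have "cmod \<rho> * cmod (w z) = cmod (\<Sum>x\<in>V. of_int (A z x) * w x)"
    using e z(1) unfolding is_eigvec_def by (simp add: norm_mult)
  also have "\<dots> \<le> (\<Sum>x\<in>V. \<bar>real_of_int (A z x)\<bar> * cmod (w z))"
    using z(2) by (intro sum_norm_le) (auto simp: norm_mult intro!: mult_left_mono)
  also have "\<dots> \<le> k * cmod (w z)"
    unfolding sum_distrib_right[symmetric] using k[OF z(1)] by (rule mult_right_mono) simp
  finally show ?thesis using pos by simp
qed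

text \<open>For the cofactor \<open>g\<close> of a root the vector \<open>g(A) e_u\<close> is
  nonzero by minimality of the degree, and it is an eigenvector because \<open>minpol\<close>
  annihilates \<open>e_u\<close>.\<close>

lemma root_factor:
  assumes "poly (map_poly of_int minpol) \<rho> = 0"
  obtains g where "map_poly of_int minpol = [:- \<rho>, 1:] * g" "is_eigvec \<rho> (kvec g)" "kvec g u \<noteq> 0"
proof -
  obtain g where g: "map_poly of_int minpol = [:- \<rho>, 1:] * g"
    using assms by (auto simp: poly_eq_0_iff_dvd dvd_def)
  have g0: "g \<noteq> 0" using g map_poly_minpol_nz by auto
  have "mdeg = Polynomial.degree ([:- \<rho>, 1:] * g)" unfolding g[symmetric] by (simp add: degree_map_poly)
  also have "\<dots> = Suc (Polynomial.degree g)" using g0 by (subst degree_mult_eq) auto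
  finally have "Polynomial.degree g < mdeg" by simp
  then obtain v where v: "v \<in> V" "kvec g v \<noteq> 0" using kvec_independent g0 by blast
  have e: "is_eigvec \<rho> (kvec g)"
    unfolding is_eigvec_def using kvec_minpol unfolding g kvec_linear_factor by auto
  \<comment> \<open>An eigenvector vanishing at \<open>u\<close> pairs to 0 with every Krylov
    vector. The conjugate of \<open>kvec g\<close> is a combination of these, so
    \<open>kvec g\<close> would have norm 0.\<close>
  have "kvec g u \<noteq> 0"
  proof
    assume z: "kvec g u = 0"
    have c: "cnj (kvec g v) = lin_eval (map_poly cnj g) (\<lambda>i. of_int (krylov_vec i v))" for v
      unfolding kvec_def lin_eval_def by (simp add: coeff_map_poly degree_map_poly)
    have "(\<Sum>v\<in>V. kvec g v * cnj (kvec g v)) = lin_eval (map_poly cnj g) (\<lambda>i. \<Sum>v\<in>V. kvec g v * of_int (krylov_vec i v))"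
      unfolding c lin_eval_sum_right ..
    also have "\<dots> = 0" unfolding eigvec_adjoint[OF e] z by (simp add: lin_eval_def)
    finally have "(\<Sum>v\<in>V. cnj (kvec g v) * kvec g v) = 0" by (simp add: mult.commute)
    from sum_cnj_self_eq_0[OF this v(1)] v(2) show False by simp
  qed
  with g e that show ?thesis by blast
qed

lemma root_real:
  fixes \<rho> :: complex
  assumes "poly (map_poly of_int minpol) \<rho> = 0"
  shows "\<rho> \<in> \<real>"
  using root_factor[OF assms] eigvec_real uV by metis

text \<open>For real \<rho> the operator \<open>A - \<rho>\<close> is self-adjoint, so if its square
  kills a vector then so does the operator itself. A double root would thus lead to an annihilating
  polynomial of smaller degree.\<close>

lemma rsquarefree_minpol: "rsquarefree (map_poly of_int minpol :: complex poly)"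
proof -
  let ?f = "map_poly of_int minpol :: complex poly"
  have f0: "?f \<noteq> 0" by (rule map_poly_minpol_nz)
  have "order \<rho> ?f = 0 \<or> order \<rho> ?f = 1" for \<rho>
  proof (rule ccontr)
    assume "\<not> ?thesis"
    then have 2: "2 \<le> order \<rho> ?f" by simp
    then have "poly ?f \<rho> = 0" using order_root[of ?f \<rho>] by simp
    then have re: "\<rho> \<in> \<real>" by (rule root_real)
    have "[:- \<rho>, 1:] ^ 2 dvd ?f" using 2 f0 order_divides by blast
    then obtain h where "?f = [:- \<rho>, 1:] ^ 2 * h" by (elim dvdE)
    then have h: "?f = [:- \<rho>, 1:] * ([:- \<rho>, 1:] * h)" by (simp only: power2_eq_square mult.assoc)
    let ?w = "kvec ([:- \<rho>, 1:] * h)"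
    have h0: "h \<noteq> 0" using h f0 by auto
    have nz: "[:- \<rho>, 1:] * h \<noteq> 0" by (rule no_zero_divisors[OF _ h0]) simp
    have "mdeg = Polynomial.degree ([:- \<rho>, 1:] * ([:- \<rho>, 1:] * h))" unfolding h[symmetric] by (simp add: degree_map_poly)
    also have "\<dots> = Suc (Polynomial.degree ([:- \<rho>, 1:] * h))" by (subst degree_mult_eq[OF _ nz]) simp_all
    finally have d: "Polynomial.degree ([:- \<rho>, 1:] * h) < mdeg" by simp
    obtain v where v: "v \<in> V" "?w v \<noteq> 0" using nz kvec_independent[OF d] by blast
    have Aw: "(\<Sum>x\<in>V. of_int (A v x) * ?w x) - \<rho> * ?w v = 0" if "v \<in> V" for v
      using kvec_minpol[OF that] unfolding h kvec_linear_factor[of \<rho> "[:- \<rho>, 1:] * h"] .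
    have "cnj (?w v) = cnj (\<Sum>x\<in>V. of_int (A v x) * kvec h x) - cnj (\<rho> * kvec h v)" for v
      by (simp only: kvec_linear_factor complex_cnj_diff)
    then have "(\<Sum>v\<in>V. cnj (?w v) * ?w v) = (\<Sum>v\<in>V. cnj (\<Sum>x\<in>V. of_int (A v x) * kvec h x) * ?w v - cnj (\<rho> * kvec h v) * ?w v)"
      by (simp only: left_diff_distrib)
    also have "\<dots> = (\<Sum>v\<in>V. cnj (kvec h v) * (\<Sum>x\<in>V. of_int (A v x) * ?w x)) - (\<Sum>v\<in>V. cnj (\<rho> * kvec h v) * ?w v)"
      unfolding sum_subtractf self_adjoint ..
    also have "\<dots> = (\<Sum>v\<in>V. cnj (kvec h v) * ((\<Sum>x\<in>V. of_int (A v x) * ?w x) - \<rho> * ?w v))"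
      using re unfolding sum_subtractf[symmetric] by (intro sum.cong refl) (simp add: Reals_cnj_iff algebra_simps)
    also have "\<dots> = 0" using Aw by simp
    finally have "(\<Sum>v\<in>V. cnj (?w v) * ?w v) = 0" .
    from sum_cnj_self_eq_0[OF this v(1)] v(2) show False by simp
  qed
  then show ?thesis using f0 unfolding rsquarefree_def by blast
qed

end

context zspan
begin

lemma rep_exI:
  assumes "\<And>i. i \<in> I \<Longrightarrow> \<exists>c. x * \<omega> i = (\<Sum>j\<in>I. of_int (c j) * \<omega> j)"
  shows "\<exists>H. rep x H"
proof -
  obtain c where c: "\<And>i. i \<in> I \<Longrightarrow> x * \<omega> i = (\<Sum>j\<in>I. of_int (c i j) * \<omega> j)"
    using assms by metis
  have "rep x (\<Sum>i\<in>I. \<Sum>j\<in>I. \<bar>real_of_int (c i j)\<bar>)"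
    unfolding rep_def
  proof (intro exI ballI conjI)
    fix i assume i: "i \<in> I"
    show "x * \<omega> i = (\<Sum>j\<in>I. of_int (c i j) * \<omega> j)" using c[OF i] .
    show "(\<Sum>j\<in>I. \<bar>real_of_int (c i j)\<bar>) \<le> (\<Sum>i\<in>I. \<Sum>j\<in>I. \<bar>real_of_int (c i j)\<bar>)"
      using i finI by (intro member_le_sum[of i I "\<lambda>i. \<Sum>j\<in>I. \<bar>real_of_int (c i j)\<bar>"]) (auto intro: sum_nonneg)
  qed
  then show ?thesis ..
qed

lemma rep_poly:
  assumes "rep x H"
  shows "\<exists>H. rep (poly (map_poly of_int p) x) H"
proof
  show "rep (poly (map_poly of_int p) x)
     (\<Sum>i\<le>Polynomial.degree (map_poly of_int p :: complex poly). \<bar>of_int (coeff p i)\<bar> * H ^ i)"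
    unfolding poly_altdef by (intro rep_sum) (auto simp: coeff_map_poly intro!: rep_mult rep_of_int rep_power assms)
qed

end

section \<open>Rationality and integrality of squares of roots\<close>

lemma sum_roots_squared_rational:
  fixes f :: "int poly" and R :: "complex set"
  assumes R: "finite R" and f: "map_poly of_int f = smult c (\<Prod>z\<in>R. [:- z, 1:])" and f0: "f \<noteq> 0"
  shows "(\<Sum>z\<in>R. z\<^sup>2) \<in> \<rat>"
proof -
  \<comment> \<open>reversing the coefficients moves the first two elementary symmetric functions to fixed positions\<close>
  let ?Q = "\<lambda>R. \<Prod>z\<in>R. [:1, - z:]"
  have Q: "coeff (?Q R) 0 = 1 \<and> coeff (?Q R) 1 = - (\<Sum>z\<in>R. z) \<and> 2 * coeff (?Q R) 2 = (\<Sum>z\<in>R. z)\<^sup>2 - (\<Sum>z\<in>R. z\<^sup>2)"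
    using R
  proof (induction rule: finite_induct)
    case (insert z R)
    have "[:1, - z:] * q = q - pCons 0 (smult z q)" for q by simp
    then show ?case using insert by (simp add: coeff_pCons numeral_2_eq_2 power2_eq_square algebra_simps)
  qed simp
  have "reflect_poly (map_poly of_int f) = smult c (?Q R)"
    unfolding f reflect_poly_smult reflect_poly_prod by (simp add: reflect_poly_pCons reflect_poly_def)
  then have cf: "c * coeff (?Q R) i = coeff (reflect_poly (map_poly of_int f)) i" for i by simp
  have int: "coeff (reflect_poly (map_poly of_int f :: complex poly)) i \<in> \<rat>" for i
    by (simp add: coeff_reflect_poly coeff_map_poly)
  have c: "c \<in> \<rat>" using int[of 0] cf[of 0] Q by simp
  have c0: "c \<noteq> 0" using f f0 by (auto simp: poly_eq_iff coeff_map_poly)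
  have q: "coeff (?Q R) i \<in> \<rat>" for i
  proof -
    have "coeff (?Q R) i = coeff (reflect_poly (map_poly of_int f)) i / c" using cf[of i] c0 by (simp add: field_simps)
    then show ?thesis using int c by (simp only: Rats_divide)
  qed
  have "(\<Sum>z\<in>R. z\<^sup>2) = (- coeff (?Q R) 1)\<^sup>2 - 2 * coeff (?Q R) 2" using Q by simp
  also have "\<dots> \<in> \<rat>" by (intro Rats_diff Rats_mult Rats_power q) (use q in auto)
  finally show ?thesis .
qed

lemma of_real_of_rat: "of_real (of_rat r) = (of_rat r :: 'c :: real_field)"
  by (cases r) (simp add: of_rat_rat)

text \<open>If \<open>q\<close> is the reduced denominator of \<open>c\<close>, then every power of
  \<open>q\<close> divides the fixed nonzero \<open>L\<close>, so \<open>q = 1\<close>.\<close>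

lemma rat_Ints_if_powers:
  fixes c :: rat and L :: int
  assumes L: "L \<noteq> 0" and c: "\<And>j. of_int L * c ^ j \<in> \<int>"
  shows "c \<in> \<int>"
proof -
  obtain p q where pq: "quotient_of c = (p, q)" by fastforce
  have q: "q > 0" "coprime p q" "c = of_int p / of_int q"
    using quotient_of_denom_pos[OF pq] quotient_of_coprime[OF pq] quotient_of_div[OF pq] by auto
  have dvd: "q ^ j dvd L" for j
  proof -
    obtain m where m: "of_int L * c ^ j = rat_of_int m" using c by (auto elim: Ints_cases)
    have "rat_of_int (L * p ^ j) = of_int (m * q ^ j)"
      using m q by (simp add: power_divide field_simps)
    then have "L * p ^ j = m * q ^ j" by (simp only: of_int_eq_iff)
    then have "q ^ j dvd L * p ^ j" by simp
    moreover have "coprime (q ^ j) (p ^ j)" using q(2) by (simp add: coprime_commute)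
    ultimately show ?thesis using coprime_dvd_mult_left_iff by blast
  qed
  have "q = 1"
  proof (rule ccontr)
    assume "q \<noteq> 1"
    then have q2: "2 \<le> q" using q(1) by simp
    define j where "j = nat \<bar>L\<bar>"
    have "\<bar>L\<bar> < 2 ^ j" unfolding j_def using of_nat_less_two_power[of "nat \<bar>L\<bar>", where 'a = int] by simp
    also have "(2::int) ^ j \<le> q ^ j" using q2 by (intro power_mono) auto
    also have "\<dots> \<le> \<bar>L\<bar>" using dvd[of j] L q(1) by (metis dvd_imp_le_int abs_of_nonneg less_imp_le zero_le_power)
    finally show False by simp
  qed
  then show ?thesis using q(3) by simp
qed

context krylov
begin

text \<open>Shifting the relation given by \<open>minpol\<close> expresses a nonzero multiple of
  each later Krylov vector through earlier ones. Hence a vertex reached by any walk is seen by some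
  Krylov vector of index below \<open>mdeg\<close>.\<close>

lemma krylov_vec_eq_0:
  assumes v: "v \<in> V" and z: "\<And>i. i < mdeg \<Longrightarrow> krylov_vec i v = 0"
  shows "krylov_vec i v = 0"
proof (induction i rule: less_induct)
  case (less i)
  show ?case
  proof (cases "i < mdeg")
    case False
    define m where "m = i - mdeg"
    have sh: "\<forall>v\<in>V. lin_eval minpol (\<lambda>i. krylov_vec (i + m) v) = 0" for m
    proof (induction m)
      case 0
      show ?case using annihilates_minpol by (simp add: annihilates_def)
    next
      case (Suc m)
      have "lin_eval minpol (\<lambda>i. krylov_vec (i + Suc m) v) = (\<Sum>x\<in>V. A v x * lin_eval minpol (\<lambda>i. krylov_vec (i + m) x))" for v
        unfolding lin_eval_sum_right by simp
      then show ?case using Suc by simp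
    qed
    have "0 = (\<Sum>i\<le>mdeg. coeff minpol i * krylov_vec (i + m) v)"
      using sh[of m] v unfolding lin_eval_def by simp
    also have "\<dots> = (\<Sum>i\<in>{mdeg}. coeff minpol i * krylov_vec (i + m) v)"
      using less False by (intro sum.mono_neutral_right) (auto simp: m_def)
    finally show ?thesis using minpol_nz False by (simp add: m_def)
  qed (use z in simp)
qed

text \<open>Pairing \<open>U\<close> with an eigenvector gives
  \<open>exp (t * \<rho>) * w u\<close>, while \<open>s0\<close> and \<open>s1\<close> pair to
  polynomial values in \<rho>. The same \<open>M\<close>, \<open>P\<close> and \<open>Q\<close>
  serve all eigenvalues.\<close>

lemma exp_eigenvalue_algebraic:
  fixes s0 s1 :: "'a \<Rightarrow> int" and n :: nat
  assumes n: "0 < n"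
    and U: "\<And>v. v \<in> V \<Longrightarrow> (\<lambda>j. t ^ j / fact j * of_int (krylov_vec j v)) sums U v"
    and s: "\<And>v. v \<in> V \<Longrightarrow> of_real (sqrt n) * U v = of_int (s0 v) + \<i> * of_int (s1 v)"
  obtains M :: int and P Q :: "int poly" where "M \<noteq> 0"
    "\<And>\<rho> w. is_eigvec \<rho> w \<Longrightarrow> w u \<noteq> 0 \<Longrightarrow>
       of_int M * exp (2 * t * \<rho>) = (poly (map_poly of_int P) \<rho> + \<i> * poly (map_poly of_int Q) \<rho>)\<^sup>2"
proof -
  \<comment> \<open>A rational functional that kills all Krylov vectors kills the sum
    \<open>U\<close> of the series, hence \<open>s0 + \<i> s1\<close>. Its values on
    \<open>s0\<close> and \<open>s1\<close> are real, so both vanish.\<close>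
  have dual: "(\<Sum>v\<in>V. y v * of_int (s0 v)) = 0 \<and> (\<Sum>v\<in>V. y v * of_int (s1 v)) = 0"
    if y: "\<And>j. (\<Sum>v\<in>V. y v * of_int (krylov_vec j v)) = 0" for y :: "'a \<Rightarrow> rat"
  proof -
    have y': "(\<Sum>v\<in>V. of_rat (y v) * (of_int (krylov_vec j v) :: complex)) = 0" for j
    proof -
      have "(\<Sum>v\<in>V. of_rat (y v) * (of_int (krylov_vec j v) :: complex)) = of_rat (\<Sum>v\<in>V. y v * of_int (krylov_vec j v))"
        by (simp add: of_rat_sum of_rat_mult)
      then show ?thesis using y by simp
    qed
    have "(\<lambda>j. \<Sum>v\<in>V. of_rat (y v) * (t ^ j / fact j * of_int (krylov_vec j v))) sums (\<Sum>v\<in>V. of_rat (y v) * U v)"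
      by (intro sums_sum sums_mult U)
    moreover have "(\<Sum>v\<in>V. of_rat (y v) * (t ^ j / fact j * of_int (krylov_vec j v))) = 0" for j
    proof -
      have "(\<Sum>v\<in>V. of_rat (y v) * (t ^ j / fact j * of_int (krylov_vec j v)))
         = t ^ j / fact j * (\<Sum>v\<in>V. of_rat (y v) * of_int (krylov_vec j v))"
        by (simp add: sum_distrib_left mult_ac)
      then show ?thesis using y' by simp
    qed
    ultimately have "(\<lambda>j. 0) sums (\<Sum>v\<in>V. of_rat (y v) * U v)" by simp
    then have "(\<Sum>v\<in>V. of_rat (y v) * U v) = 0" using sums_unique2[OF _ sums_zero] by blast
    moreover have "(\<Sum>v\<in>V. of_rat (y v) * (of_real (sqrt n) * U v)) = of_real (sqrt n) * (\<Sum>v\<in>V. of_rat (y v) * U v)"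
      by (simp add: sum_distrib_left mult_ac)
    ultimately have "(\<Sum>v\<in>V. of_rat (y v) * (of_real (sqrt n) * U v)) = 0" by simp
    then have "(\<Sum>v\<in>V. of_rat (y v) * (of_int (s0 v) + \<i> * of_int (s1 v))) = (0::complex)"
      using s by simp
    moreover have "(\<Sum>v\<in>V. of_rat (y v) * (of_int (s0 v) + \<i> * of_int (s1 v)))
       = complex_of_real (of_rat (\<Sum>v\<in>V. y v * of_int (s0 v))) + \<i> * complex_of_real (of_rat (\<Sum>v\<in>V. y v * of_int (s1 v)))"
      by (simp add: of_real_of_rat of_rat_sum of_rat_mult sum.distrib sum_distrib_left algebra_simps)
    ultimately show ?thesis by (simp add: complex_eq_iff)
  qed
  have dual0: "(\<Sum>v\<in>V. y v * of_int (s0 v)) = 0"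
    if "\<And>j. j \<in> UNIV \<Longrightarrow> (\<Sum>v\<in>V. y v * of_int (krylov_vec j v)) = 0" for y :: "'a \<Rightarrow> rat"
    using dual that by simp
  obtain p0 N0 where p0: "N0 \<noteq> 0" "\<And>v. v \<in> V \<Longrightarrow> N0 * s0 v = lin_eval p0 (\<lambda>i. krylov_vec i v)"
    by (rule int_vector_in_span[of V UNIV krylov_vec s0, OF finV dual0]) blast+
  have dual1: "(\<Sum>v\<in>V. y v * of_int (s1 v)) = 0"
    if "\<And>j. j \<in> UNIV \<Longrightarrow> (\<Sum>v\<in>V. y v * of_int (krylov_vec j v)) = 0" for y :: "'a \<Rightarrow> rat"
    using dual that by simp
  obtain p1 N1 where p1: "N1 \<noteq> 0" "\<And>v. v \<in> V \<Longrightarrow> N1 * s1 v = lin_eval p1 (\<lambda>i. krylov_vec i v)"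
    by (rule int_vector_in_span[of V UNIV krylov_vec s1, OF finV dual1]) blast+
  have ev: "(\<Sum>v\<in>V. w v * of_int (lin_eval p (\<lambda>i. krylov_vec i v))) = poly (map_poly of_int p) \<rho> * w u"
    if "is_eigvec \<rho> w" for \<rho> w p
    unfolding lin_eval_of_int[symmetric] lin_eval_sum_right eigvec_adjoint[OF that] lin_eval_mult_right lin_eval_power ..
  \<comment> \<open>\<open>N0\<close> and \<open>N1\<close> are the denominators for
    \<open>s0\<close> and \<open>s1\<close>, cross-multiplied to a common one; the factor
    \<open>n\<close> is the square of \<open>sqrt n\<close>.\<close>
  show ?thesis
  proof (rule that[of "(N0 * N1)\<^sup>2 * int n" "smult N1 p0" "smult N0 p1"])
    show "(N0 * N1)\<^sup>2 * int n \<noteq> 0" using n p0(1) p1(1) by simp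
    fix \<rho> w assume e: "is_eigvec \<rho> w" and wu: "w u \<noteq> 0"
    have "(\<lambda>j. \<Sum>v\<in>V. w v * (t ^ j / fact j * of_int (krylov_vec j v))) sums (\<Sum>v\<in>V. w v * U v)"
      by (intro sums_sum sums_mult U)
    moreover have "(\<Sum>v\<in>V. w v * (t ^ j / fact j * of_int (krylov_vec j v))) = (t * \<rho>) ^ j / fact j * w u" for j
    proof -
      have "(\<Sum>v\<in>V. w v * (t ^ j / fact j * of_int (krylov_vec j v)))
         = t ^ j / fact j * (\<Sum>v\<in>V. w v * of_int (krylov_vec j v))"
        by (simp add: sum_distrib_left mult_ac)
      then show ?thesis unfolding eigvec_adjoint[OF e] by (simp add: power_mult_distrib)
    qed
    ultimately have 1: "(\<lambda>j. (t * \<rho>) ^ j / fact j * w u) sums (\<Sum>v\<in>V. w v * U v)" by simp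
    have 2: "(\<lambda>j. (t * \<rho>) ^ j / fact j * w u) sums (exp (t * \<rho>) * w u)"
      using exp_converges[of "t * \<rho>"] by (intro sums_mult2) (simp add: scaleR_conv_of_real divide_inverse mult.commute)
    have 3: "(\<Sum>v\<in>V. w v * U v) = exp (t * \<rho>) * w u" by (rule sums_unique2[OF 1 2])
    let ?r = "complex_of_real (sqrt n)"
    have "of_int (N0 * N1) * (?r * (exp (t * \<rho>) * w u)) = (\<Sum>v\<in>V. of_int (N0 * N1) * w v * (?r * U v))"
      unfolding 3[symmetric] by (simp add: sum_distrib_left mult_ac)
    also have "\<dots> = (\<Sum>v\<in>V. of_int N1 * (w v * of_int (N0 * s0 v)) + \<i> * of_int N0 * (w v * of_int (N1 * s1 v)))"
      using s by (intro sum.cong refl) (simp add: algebra_simps)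
    also have "\<dots> = of_int N1 * (\<Sum>v\<in>V. w v * of_int (N0 * s0 v)) + \<i> * of_int N0 * (\<Sum>v\<in>V. w v * of_int (N1 * s1 v))"
      unfolding sum.distrib sum_distrib_left ..
    also have "\<dots> = of_int N1 * (\<Sum>v\<in>V. w v * of_int (lin_eval p0 (\<lambda>i. krylov_vec i v)))
        + \<i> * of_int N0 * (\<Sum>v\<in>V. w v * of_int (lin_eval p1 (\<lambda>i. krylov_vec i v)))"
      using p0(2) p1(2) by simp
    also have "\<dots> = (poly (map_poly of_int (smult N1 p0)) \<rho> + \<i> * poly (map_poly of_int (smult N0 p1)) \<rho>) * w u"
      unfolding ev[OF e] by (simp add: map_poly_smult algebra_simps)
    finally have "of_int (N0 * N1) * (?r * exp (t * \<rho>)) = poly (map_poly of_int (smult N1 p0)) \<rho> + \<i> * poly (map_poly of_int (smult N0 p1)) \<rho>"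
      using mult_right_cancel[OF wu] by (simp only: mult.assoc[symmetric])
    then have "(poly (map_poly of_int (smult N1 p0)) \<rho> + \<i> * poly (map_poly of_int (smult N0 p1)) \<rho>)\<^sup>2
       = (of_int (N0 * N1) * (?r * exp (t * \<rho>)))\<^sup>2" by (simp only:)
    also have "\<dots> = (of_int (N0 * N1))\<^sup>2 * (?r\<^sup>2 * (exp (t * \<rho>))\<^sup>2)"
      by (simp only: power_mult_distrib)
    also have "?r\<^sup>2 = of_nat n" by (simp flip: of_real_power)
    also have "(exp (t * \<rho>))\<^sup>2 = exp (2 * t * \<rho>)" by (simp add: power2_eq_square mult_ac flip: exp_add)
    finally show "of_int ((N0 * N1)\<^sup>2 * int n) * exp (2 * t * \<rho>)
       = (poly (map_poly of_int (smult N1 p0)) \<rho> + \<i> * poly (map_poly of_int (smult N0 p1)) \<rho>)\<^sup>2"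
      by (simp add: mult_ac)
  qed
qed

text \<open>One vector has to serve both eigenvalues and \<i>: the tensor product of
  \<open>w1\<close>, \<open>w2\<close> and the pair (1, \<i>). On it \<rho>1 acts through
  \<open>A\<close> on the first factor, \<rho>2 through \<open>A\<close> on the second, and \<i> by
  a signed swap on the third.\<close>

lemma eigenvalues_dependent:
  assumes e1: "is_eigvec \<rho>1 w1" "w1 u \<noteq> 0" and e2: "is_eigvec \<rho>2 w2" "w2 u \<noteq> 0"
    and M: "M \<noteq> 0" and t: "t \<noteq> 0"
    and alg: "\<And>\<rho> w. is_eigvec \<rho> w \<Longrightarrow> w u \<noteq> 0 \<Longrightarrow>
       of_int M * exp (t * \<rho>) = (poly (map_poly of_int P) \<rho> + \<i> * poly (map_poly of_int Q) \<rho>)\<^sup>2"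
  shows "\<exists>a b :: int. (a \<noteq> 0 \<or> b \<noteq> 0) \<and> of_int a * \<rho>1 + of_int b * \<rho>2 = 0"
proof -
  let ?\<omega> = "\<lambda>(v, v', c). w1 v * w2 v' * (if c then \<i> else 1)"
  let ?I = "V \<times> V \<times> (UNIV :: bool set)"
  interpret zspan ?I ?\<omega> "(u, u, False)"
    by unfold_locales (use finV uV e1 e2 in auto)
  obtain H1 where H1: "rep \<rho>1 H1"
  proof -
    have "\<exists>H. rep \<rho>1 H"
    proof (rule rep_exI)
      fix i assume "i \<in> ?I"
      then obtain v v' c where i: "i = (v, v', c)" "v \<in> V" "v' \<in> V" by auto
      let ?c = "\<lambda>(x, x', c'). if x' = v' \<and> c' = c then A v x else 0"
      have "(\<Sum>j\<in>?I. of_int (?c j) * ?\<omega> j) = (\<Sum>j\<in>(\<lambda>x. (x, v', c)) ` V. of_int (?c j) * ?\<omega> j)"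
        using finV i by (intro sum.mono_neutral_right) auto
      also have "\<dots> = (\<Sum>x\<in>V. of_int (A v x) * w1 x) * (w2 v' * (if c then \<i> else 1))"
        by (subst sum.reindex) (auto simp: inj_on_def sum_distrib_right mult.assoc)
      also have "\<dots> = \<rho>1 * ?\<omega> i" using e1(1) i unfolding is_eigvec_def by simp
      finally show "\<exists>c. \<rho>1 * ?\<omega> i = (\<Sum>j\<in>?I. of_int (c j) * ?\<omega> j)" by (intro exI[of _ ?c]) (rule sym)
    qed
    then show thesis using that by blast
  qed
  obtain H2 where H2: "rep \<rho>2 H2"
  proof -
    have "\<exists>H. rep \<rho>2 H"
    proof (rule rep_exI)
      fix i assume "i \<in> ?I"
      then obtain v v' c where i: "i = (v, v', c)" "v \<in> V" "v' \<in> V" by auto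
      let ?c = "\<lambda>(x, x', c'). if x = v \<and> c' = c then A v' x' else 0"
      have "(\<Sum>j\<in>?I. of_int (?c j) * ?\<omega> j) = (\<Sum>j\<in>(\<lambda>x. (v, x, c)) ` V. of_int (?c j) * ?\<omega> j)"
        using finV i by (intro sum.mono_neutral_right) auto
      also have "\<dots> = (\<Sum>x\<in>V. of_int (A v' x) * w2 x) * (w1 v * (if c then \<i> else 1))"
        by (subst sum.reindex) (auto simp: inj_on_def sum_distrib_left sum_distrib_right mult_ac)
      also have "\<dots> = \<rho>2 * ?\<omega> i" using e2(1) i unfolding is_eigvec_def by simp
      finally show "\<exists>c. \<rho>2 * ?\<omega> i = (\<Sum>j\<in>?I. of_int (c j) * ?\<omega> j)" by (intro exI[of _ ?c]) (rule sym)
    qed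
    then show thesis using that by blast
  qed
  obtain Hi where Hi: "rep \<i> Hi"
  proof -
    have "\<exists>H. rep \<i> H"
    proof (rule rep_exI)
      fix i assume "i \<in> ?I"
      then obtain v v' c where i: "i = (v, v', c)" "v \<in> V" "v' \<in> V" by auto
      let ?c = "\<lambda>j. if j = (v, v', \<not> c) then (if c then - 1 else 1) else 0 :: int"
      have "(\<Sum>j\<in>?I. of_int (?c j) * ?\<omega> j) = (\<Sum>j\<in>{(v, v', \<not> c)}. of_int (?c j) * ?\<omega> j)"
        using finV i by (intro sum.mono_neutral_right) auto
      also have "\<dots> = \<i> * ?\<omega> i" using i by simp
      finally show "\<exists>c. \<i> * ?\<omega> i = (\<Sum>j\<in>?I. of_int (c j) * ?\<omega> j)" by (intro exI[of _ ?c]) (rule sym)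
    qed
    then show thesis using that by blast
  qed
  have ex: "\<exists>H. rep ((poly (map_poly of_int P) x + \<i> * poly (map_poly of_int Q) x)\<^sup>2) H" if "rep x H" for x H
    using rep_poly[OF that, of P] rep_poly[OF that, of Q] by (blast intro: rep_power rep_add rep_mult[OF Hi])
  obtain K1 K2 where "rep ((poly (map_poly of_int P) \<rho>1 + \<i> * poly (map_poly of_int Q) \<rho>1)\<^sup>2) K1"
    "rep ((poly (map_poly of_int P) \<rho>2 + \<i> * poly (map_poly of_int Q) \<rho>2)\<^sup>2) K2"
    using ex[OF H1] ex[OF H2] by blast
  from gelfond_schneider[OF H1 H2 this M alg[OF e1] alg[OF e2] t] show ?thesis .
qed

lemma eigenvalue_square_Ints:
  assumes e: "is_eigvec \<rho> w" and wu: "w u \<noteq> 0" and c: "\<rho>\<^sup>2 = of_rat c"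
  shows "c \<in> \<int>"
proof -
  interpret vector_space "\<lambda>(c::rat) (z::complex). of_rat c * z"
    by unfold_locales (auto simp: algebra_simps of_rat_add of_rat_mult)
  \<comment> \<open>a rational functional turns \<open>w\<close> into a rational eigenvector of the square of \<open>A\<close>\<close>
  obtain \<phi> :: "complex \<Rightarrow> rat" where \<phi>: "\<And>y z. \<phi> (y + z) = \<phi> y + \<phi> z"
    "\<And>c y. \<phi> (of_rat c * y) = c * \<phi> y" "\<phi> (w u) = 1"
    by (rule exists_functional[of "w u" "{}"]) (use wu in auto)
  have \<phi>0: "\<phi> 0 = 0" using \<phi>(2)[of 0 0] by simp
  have \<phi>sum: "\<phi> (\<Sum>x\<in>V. of_int (b x) * w x) = (\<Sum>x\<in>V. of_int (b x) * \<phi> (w x))" for b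
  proof -
    have "\<phi> (\<Sum>x\<in>W. of_rat (of_int (b x)) * w x) = (\<Sum>x\<in>W. of_int (b x) * \<phi> (w x))" if "finite W" for W
      using that by (induction rule: finite_induct) (simp_all only: \<phi>0 \<phi>(1,2) sum.empty sum.insert not_False_eq_True)
    from this[OF finV] show ?thesis by simp
  qed
  have sq: "\<exists>b :: 'a \<Rightarrow> int. (\<rho>\<^sup>2) ^ j * w v = (\<Sum>x\<in>V. of_int (b x) * w x)" if "v \<in> V" for j v
  proof -
    have "\<exists>b :: 'a \<Rightarrow> int. \<rho> ^ j * w v = (\<Sum>x\<in>V. of_int (b x) * w x)" if "v \<in> V" for j v
      using that
    proof (induction j arbitrary: v)
      case 0
      have "(\<Sum>x\<in>V. of_int (if x = v then 1 else 0) * w x) = (\<Sum>x\<in>V. if x = v then w x else 0)"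
        by (intro sum.cong) auto
      also have "\<dots> = w v" using finV 0 by simp
      finally show ?case by (intro exI[of _ "\<lambda>x. if x = v then 1 else 0"]) simp
    next
      case (Suc j)
      obtain b where b: "\<And>x. x \<in> V \<Longrightarrow> \<rho> ^ j * w x = (\<Sum>y\<in>V. of_int (b x y :: int) * w y)"
        using Suc.IH by metis
      have "\<rho> ^ Suc j * w v = \<rho> ^ j * (\<Sum>x\<in>V. of_int (A v x) * w x)"
        using e Suc.prems unfolding is_eigvec_def by simp
      also have "\<dots> = (\<Sum>x\<in>V. of_int (A v x) * (\<rho> ^ j * w x))" by (simp add: sum_distrib_left mult_ac)
      also have "\<dots> = (\<Sum>x\<in>V. \<Sum>y\<in>V. of_int (A v x * b x y) * w y)"
        using b by (simp add: sum_distrib_left mult_ac)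
      also have "\<dots> = (\<Sum>y\<in>V. of_int (\<Sum>x\<in>V. A v x * b x y) * w y)"
        by (subst sum.swap) (simp add: sum_distrib_right)
      finally show ?case by (rule exI[of _ "\<lambda>y. \<Sum>x\<in>V. A v x * b x y"])
    qed
    from this[OF that, of "2 * j"] show ?thesis by (simp add: power_mult)
  qed
  \<comment> \<open>A common denominator of the values \<open>\<phi> (w x)\<close>. Every
    \<open>c ^ j\<close> is an integer combination of these values, so \<open>L\<close> clears all
    powers of \<open>c\<close> at once.\<close>
  define L where "L = (\<Prod>x\<in>V. snd (quotient_of (\<phi> (w x))))"
  have L: "L \<noteq> 0" unfolding L_def using finV
    by (metis prod_zero_iff quotient_of_denom_pos' less_irrefl)
  have Lz: "of_int L * \<phi> (w x) \<in> \<int>" if "x \<in> V" for x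
  proof -
    have q: "\<phi> (w x) = of_int (fst (quotient_of (\<phi> (w x)))) / of_int (snd (quotient_of (\<phi> (w x))))"
      using quotient_of_div by (metis prod.collapse)
    have p: "snd (quotient_of (\<phi> (w x))) > 0" by (rule quotient_of_denom_pos')
    have "L = snd (quotient_of (\<phi> (w x))) * (\<Prod>x\<in>V - {x}. snd (quotient_of (\<phi> (w x))))"
      unfolding L_def using finV that by (rule prod.remove)
    then have "of_int L * \<phi> (w x) = of_int ((\<Prod>x\<in>V - {x}. snd (quotient_of (\<phi> (w x)))) * fst (quotient_of (\<phi> (w x))))"
      using p by (subst q) (simp add: field_simps)
    then show ?thesis by (metis Ints_of_int)
  qed
  show ?thesis
  proof (rule rat_Ints_if_powers[OF L])
    fix j
    obtain b :: "'a \<Rightarrow> int" where b: "(\<rho>\<^sup>2) ^ j * w u = (\<Sum>x\<in>V. of_int (b x) * w x)" using sq[OF uV] by blast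
    have "c ^ j = \<phi> (of_rat (c ^ j) * w u)" using \<phi>(2,3) by simp
    also have "of_rat (c ^ j) = (\<rho>\<^sup>2) ^ j" unfolding c by (rule of_rat_power)
    finally have "c ^ j = (\<Sum>x\<in>V. of_int (b x) * \<phi> (w x))" unfolding b \<phi>sum .
    then have "of_int L * c ^ j = (\<Sum>x\<in>V. of_int (b x) * (of_int L * \<phi> (w x)))"
      by (simp add: sum_distrib_left mult_ac)
    also have "\<dots> \<in> \<int>" by (intro Ints_sum Ints_mult[OF Ints_of_int Lz])
    finally show "of_int L * c ^ j \<in> \<int>" .
  qed
qed

end

section \<open>Degree of the minimal polynomial and number of vertices\<close>

context krylov
begin

lemma minpol_degree_le_if_quantized:
  fixes s0 s1 :: "'a \<Rightarrow> int" and n k :: nat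
  assumes n: "0 < n" and t: "t \<noteq> 0"
    and U: "\<And>v. v \<in> V \<Longrightarrow> (\<lambda>j. t ^ j / fact j * of_int (krylov_vec j v)) sums U v"
    and s: "\<And>v. v \<in> V \<Longrightarrow> of_real (sqrt n) * U v = of_int (s0 v) + \<i> * of_int (s1 v)"
    and k: "\<And>v. v \<in> V \<Longrightarrow> (\<Sum>x\<in>V. \<bar>real_of_int (A v x)\<bar>) \<le> k"
  shows "mdeg \<le> 2 * (k\<^sup>2 + 1)"
proof -
  obtain M P Q where M: "M \<noteq> 0" and alg: "\<And>\<rho> w. is_eigvec \<rho> w \<Longrightarrow> w u \<noteq> 0 \<Longrightarrow>
       of_int M * exp (2 * t * \<rho>) = (poly (map_poly of_int P) \<rho> + \<i> * poly (map_poly of_int Q) \<rho>)\<^sup>2"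
    using exp_eigenvalue_algebraic[OF n U s] by metis
  let ?f = "map_poly of_int minpol :: complex poly"
  define R where "R = {\<rho>. poly ?f \<rho> = 0}"
  have finR: "finite R" unfolding R_def using map_poly_minpol_nz by (rule poly_roots_finite)
  have dec: "?f = smult (lead_coeff ?f) (\<Prod>z\<in>R. [:- z, 1:])"
    unfolding R_def by (rule complex_poly_decompose_rsquarefree[OF rsquarefree_minpol, symmetric])
  have "mdeg = Polynomial.degree ?f" by (simp add: degree_map_poly)
  also have "\<dots> = Polynomial.degree (\<Prod>z\<in>R. [:- z, 1:])"
    by (subst dec) (use map_poly_minpol_nz in simp)
  also have "\<dots> = card R" by (simp add: degree_prod_eq_sum_degree)
  finally have mdeg: "mdeg = card R" .
  have rt: "\<exists>w. is_eigvec \<rho> w \<and> w u \<noteq> 0" if "\<rho> \<in> R" for \<rho>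
    using root_factor[of \<rho>] that unfolding R_def by blast
  have dep: "\<exists>r. \<sigma> = of_rat r * \<rho>" if \<rho>\<sigma>: "\<rho> \<in> R" "\<sigma> \<in> R" "\<rho> \<noteq> 0" for \<rho> \<sigma>
  proof -
    obtain w1 w2 where "is_eigvec \<rho> w1" "w1 u \<noteq> 0" "is_eigvec \<sigma> w2" "w2 u \<noteq> 0"
      using rt \<rho>\<sigma> by blast
    then obtain a b :: int where ab: "a \<noteq> 0 \<or> b \<noteq> 0" "of_int a * \<rho> + of_int b * \<sigma> = 0"
      using eigenvalues_dependent[of \<rho> w1 \<sigma> w2 M "2 * t" P Q] M t alg by auto
    have b: "b \<noteq> 0" using ab \<rho>\<sigma>(3) by auto
    have "\<sigma> = of_rat (- of_int a / of_int b) * \<rho>"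
      using ab(2) b by (simp add: of_rat_divide of_rat_minus field_simps eq_neg_iff_add_eq_0)
    then show ?thesis by blast
  qed
  have sq: "\<exists>m. \<rho>\<^sup>2 = of_int m" if \<rho>: "\<rho> \<in> R" for \<rho>
  proof (cases "\<rho> = 0")
    case False
    obtain r where r: "\<And>\<sigma>. \<sigma> \<in> R \<Longrightarrow> \<sigma> = of_rat (r \<sigma>) * \<rho>" using dep[OF \<rho> _ False] by metis
    \<comment> \<open>The sum of the squares of all roots is \<open>q * \<rho>\<^sup>2\<close>;
      \<open>q\<close> is nonzero because it is a sum of rational squares one of which is 1.\<close>
    define q where "q = (\<Sum>\<sigma>\<in>R. (r \<sigma>)\<^sup>2)"
    have "r \<rho> = 1" using r[OF \<rho>] False by simp
    then have "q \<noteq> 0" unfolding q_def using finR \<rho> by (auto simp: sum_nonneg_eq_0_iff intro!: bexI[of _ \<rho>])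
    have "(\<Sum>\<sigma>\<in>R. \<sigma>\<^sup>2) = (\<Sum>\<sigma>\<in>R. of_rat ((r \<sigma>)\<^sup>2) * \<rho>\<^sup>2)"
    proof (rule sum.cong[OF refl])
      fix \<sigma> assume "\<sigma> \<in> R"
      from arg_cong[OF r[OF this], of "\<lambda>z. z\<^sup>2"] show "\<sigma>\<^sup>2 = of_rat ((r \<sigma>)\<^sup>2) * \<rho>\<^sup>2"
        by (simp only: power_mult_distrib of_rat_power)
    qed
    also have "\<dots> = of_rat q * \<rho>\<^sup>2" unfolding q_def by (simp add: of_rat_sum sum_distrib_right)
    finally have e: "of_rat q * \<rho>\<^sup>2 = (\<Sum>\<sigma>\<in>R. \<sigma>\<^sup>2)" ..
    obtain c where "(\<Sum>\<sigma>\<in>R. \<sigma>\<^sup>2) = of_rat c"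
      using sum_roots_squared_rational[OF finR dec minpol_nz] by (auto elim: Rats_cases)
    then have "\<rho>\<^sup>2 = of_rat (c / q)" using e \<open>q \<noteq> 0\<close> by (simp add: of_rat_divide field_simps)
    moreover obtain w where "is_eigvec \<rho> w" "w u \<noteq> 0" using rt[OF \<rho>] by blast
    ultimately have "c / q \<in> \<int>" using eigenvalue_square_Ints by blast
    then show ?thesis using \<open>\<rho>\<^sup>2 = of_rat (c / q)\<close> by (metis Ints_cases of_rat_of_int_eq)
  qed (auto intro: exI[of _ 0])
  have re: "\<rho> = of_real (Re \<rho>)" if "\<rho> \<in> R" for \<rho>
    using root_real[of \<rho>] that unfolding R_def by (simp add: complex_is_Real_iff complex_eq_iff)
  \<comment> \<open>A real root is determined by its square and its sign; the square is an integer
    between 0 and \<open>k\<^sup>2\<close>.\<close>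
  define g where "g \<rho> = (nat \<lfloor>(Re \<rho>)\<^sup>2\<rfloor>, 0 \<le> Re \<rho>)" for \<rho>
  have sqr: "(Re \<rho>)\<^sup>2 = real (nat \<lfloor>(Re \<rho>)\<^sup>2\<rfloor>)" if \<rho>: "\<rho> \<in> R" for \<rho>
  proof -
    obtain m where m: "\<rho>\<^sup>2 = of_int m" using sq[OF \<rho>] by blast
    have "\<rho>\<^sup>2 = of_real ((Re \<rho>)\<^sup>2)" using re[OF \<rho>] by (metis of_real_power)
    then have "(Re \<rho>)\<^sup>2 = of_int m" using m by (metis of_real_eq_iff of_real_of_int_eq)
    moreover from this have "0 \<le> m" by (metis of_int_0_le_iff zero_le_power2)
    ultimately show ?thesis by simp
  qed
  have "inj_on g R"
  proof (rule inj_onI)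
    fix \<rho> \<sigma> assume \<rho>\<sigma>: "\<rho> \<in> R" "\<sigma> \<in> R" and "g \<rho> = g \<sigma>"
    then have g: "nat \<lfloor>(Re \<rho>)\<^sup>2\<rfloor> = nat \<lfloor>(Re \<sigma>)\<^sup>2\<rfloor>" "(0 \<le> Re \<rho>) = (0 \<le> Re \<sigma>)" unfolding g_def by auto
    have "(Re \<rho>)\<^sup>2 = (Re \<sigma>)\<^sup>2" using sqr \<rho>\<sigma> g(1) by metis
    then have "Re \<rho> = Re \<sigma>" using g(2) by (auto simp: power2_eq_iff)
    then show "\<rho> = \<sigma>" using re \<rho>\<sigma> by metis
  qed
  moreover have "g ` R \<subseteq> {..k\<^sup>2} \<times> UNIV"
  proof (rule image_subsetI)
    fix \<rho> assume \<rho>: "\<rho> \<in> R"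
    obtain w where w: "is_eigvec \<rho> w" "w u \<noteq> 0" using rt[OF \<rho>] by blast
    have "cmod \<rho> \<le> real k" by (rule eigvec_norm_le[OF w(1) uV w(2) k])
    then have "\<bar>Re \<rho>\<bar> \<le> real k" using abs_Re_le_cmod order_trans by blast
    then have "(Re \<rho>)\<^sup>2 \<le> (real k)\<^sup>2" by (rule power2_le_iff_abs_le[THEN iffD2, rotated]) simp
    then have "real (nat \<lfloor>(Re \<rho>)\<^sup>2\<rfloor>) \<le> real (k\<^sup>2)" using sqr[OF \<rho>] by simp
    then show "g \<rho> \<in> {..k\<^sup>2} \<times> UNIV" unfolding g_def by (simp only: of_nat_le_iff) simp
  qed
  ultimately have "card R \<le> card ({..k\<^sup>2} \<times> (UNIV :: bool set))" by (rule card_inj_on_le) simp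
  then show ?thesis unfolding mdeg by (simp add: card_cartesian_product)
qed

text \<open>The entries of \<open>A^j e_u\<close> are nonnegative integers with sum at most
  \<open>k ^ j\<close>, so at most \<open>k ^ j\<close> of them are nonzero, and the supports for
  \<open>j < D\<close> already cover \<open>V\<close>.\<close>

lemma card_le_if_reachable:
  fixes k :: nat
  assumes A: "\<And>x y. 0 \<le> A x y" and k: "\<And>v. v \<in> V \<Longrightarrow> (\<Sum>x\<in>V. A v x) \<le> int k"
    and reach: "\<And>v. v \<in> V \<Longrightarrow> \<exists>j. krylov_vec j v \<noteq> 0" and D: "mdeg \<le> D" and k1: "1 \<le> k"
  shows "card V \<le> D * k ^ D"
proof -
  have nn: "0 \<le> krylov_vec j v" for j v
    by (induction j arbitrary: v) (auto intro!: sum_nonneg mult_nonneg_nonneg A)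
  have s: "(\<Sum>v\<in>V. krylov_vec j v) \<le> int k ^ j" for j
  proof (induction j)
    case (Suc j)
    have "(\<Sum>v\<in>V. krylov_vec (Suc j) v) = (\<Sum>x\<in>V. (\<Sum>v\<in>V. A x v) * krylov_vec j x)"
      unfolding krylov_vec.simps sum_distrib_right by (subst sum.swap) (simp only: symA)
    also have "\<dots> \<le> (\<Sum>x\<in>V. int k * krylov_vec j x)"
      using k nn by (intro sum_mono mult_right_mono)
    also have "\<dots> \<le> int k * int k ^ j" unfolding sum_distrib_left[symmetric] using Suc by (rule mult_left_mono) simp
    finally show ?case by simp
  qed (use finV uV in simp)
  have c: "card {v \<in> V. krylov_vec j v \<noteq> 0} \<le> k ^ j" for j
  proof -
    have "int (card {v \<in> V. krylov_vec j v \<noteq> 0}) = (\<Sum>v\<in>{v \<in> V. krylov_vec j v \<noteq> 0}. 1)" by simp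
    also have "\<dots> \<le> (\<Sum>v\<in>{v \<in> V. krylov_vec j v \<noteq> 0}. krylov_vec j v)"
      by (intro sum_mono) (metis (mono_tags, lifting) mem_Collect_eq nn int_one_le_iff_zero_less order_le_less)
    also have "\<dots> \<le> (\<Sum>v\<in>V. krylov_vec j v)" using finV nn by (intro sum_mono2) auto
    also have "\<dots> \<le> int (k ^ j)" using s[of j] by simp
    finally show ?thesis by (simp only: of_nat_le_iff)
  qed
  have "V \<subseteq> (\<Union>j<D. {v \<in> V. krylov_vec j v \<noteq> 0})"
  proof
    fix v assume v: "v \<in> V"
    have "\<exists>j<mdeg. krylov_vec j v \<noteq> 0" using krylov_vec_eq_0[OF v] reach[OF v] by blast
    then show "v \<in> (\<Union>j<D. {v \<in> V. krylov_vec j v \<noteq> 0})" using v D by auto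
  qed
  then have "card V \<le> card (\<Union>j<D. {v \<in> V. krylov_vec j v \<noteq> 0})" using finV by (intro card_mono) auto
  also have "\<dots> \<le> (\<Sum>j<D. card {v \<in> V. krylov_vec j v \<noteq> 0})" by (rule card_UN_le) simp
  also have "\<dots> \<le> (\<Sum>j<D. k ^ D)"
    using k1 by (intro sum_mono order_trans[OF c] power_increasing) auto
  finally show ?thesis by simp
qed

end

section \<open>Quantum walks on bipartite graphs\<close>

text \<open>\<open>matpow\<close> multiplies on the right, whereas Krylov vectors apply
  \<open>A\<close> from the left.\<close>

lemma matpow_Suc_left:
  assumes "finite V" "v \<in> V" "u \<in> V"
  shows "matpow V M (Suc j) v u = (\<Sum>x\<in>V. M v x * matpow V M j x u)"
  using assms(3)
proof (induction j arbitrary: u)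
  case 0
  have "(\<Sum>x\<in>V. (if v = x then 1 else 0) * M x u) = (\<Sum>x\<in>V. if v = x then M x u else 0)"
    by (intro sum.cong) auto
  moreover have "(\<Sum>x\<in>V. M v x * (if x = u then 1 else 0)) = (\<Sum>x\<in>V. if x = u then M v x else 0)"
    by (intro sum.cong) auto
  ultimately show ?case using assms 0 by simp
next
  case (Suc j)
  have "matpow V M (Suc (Suc j)) v u = (\<Sum>y\<in>V. matpow V M (Suc j) v y * M y u)" by (rule matpow.simps(2)[THEN fun_cong, THEN fun_cong])
  also have "\<dots> = (\<Sum>y\<in>V. (\<Sum>x\<in>V. M v x * matpow V M j x y) * M y u)" 
    by (intro sum.cong refl arg_cong2[of _ _ _ _ "(*)"] Suc.IH)
  also have "\<dots> = (\<Sum>x\<in>V. M v x * (\<Sum>y\<in>V. matpow V M j x y * M y u))"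
    unfolding sum_distrib_right sum_distrib_left mult.assoc by (rule sum.swap)
  finally show ?case by simp
qed

locale mixing_graph =
  fixes G :: "'a wgraph" and u :: 'a and k :: nat
  assumes G: "wgraph G" and conn: "connected_wgraph G" and int: "integer_weighted G"
    and bip: "bipartite_wgraph G" and deg: "max_degree G \<le> real k" and k1: "1 \<le> k"
    and u: "u \<in> verts G" and mix: "local_uniform_mixing G u"
begin

definition A :: "'a \<Rightarrow> 'a \<Rightarrow> int" where "A x y = \<lfloor>weight G x y\<rfloor>"

lemma finite_verts: "finite (verts G)" using G by (simp add: wgraph_def)

lemma edge_rel_iff: "(x, y) \<in> edge_rel G \<longleftrightarrow> weight G x y \<noteq> 0"
  using G unfolding wgraph_def edge_rel_def by (auto simp: order_less_le)

lemma of_int_A: "of_int (A x y) = weight G x y"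
proof (cases "weight G x y = 0")
  case False
  then have "weight G x y \<in> \<int>" using int edge_rel_iff unfolding integer_weighted_def by auto
  then show ?thesis unfolding A_def by (metis Ints_cases floor_of_int)
qed (simp add: A_def)

lemma A_nonneg: "0 \<le> A x y"
  using G unfolding A_def wgraph_def by simp

lemma A_sym: "A x y = A y x"
  using G unfolding A_def wgraph_def by simp

lemma sum_weight_le:
  assumes "v \<in> verts G"
  shows "(\<Sum>x\<in>verts G. weight G v x) \<le> real k"
proof -
  have "(\<Sum>x\<in>verts G. weight G v x) = Defs.degree G v"
    unfolding Defs.degree_def using finite_verts edge_rel_iff G
    by (intro sum.mono_neutral_right) (auto simp: wgraph_def)
  also have "\<dots> \<le> max_degree G" unfolding max_degree_def using finite_verts assms by (intro Max_ge) auto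
  finally show ?thesis using deg by simp
qed

sublocale krylov "verts G" A u
  by unfold_locales (use finite_verts u A_sym in auto)

lemma matpow_eq_krylov:
  assumes "v \<in> verts G"
  shows "matpow (verts G) (\<lambda>u v. \<i> * of_real t * of_real (weight G u v)) j v u = (\<i> * of_real t) ^ j * of_int (krylov_vec j v)"
  using assms
proof (induction j arbitrary: v)
  case (Suc j)
  have "matpow (verts G) (\<lambda>u v. \<i> * of_real t * of_real (weight G u v)) (Suc j) v u
     = (\<Sum>x\<in>verts G. \<i> * of_real t * of_int (A v x) * ((\<i> * of_real t) ^ j * of_int (krylov_vec j x)))"
    unfolding matpow_Suc_left[OF finite_verts Suc.prems u]
    using Suc.IH by (intro sum.cong refl) (simp flip: of_int_A)
  then show ?case by (simp add: sum_distrib_left mult_ac)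
qed simp

lemma transition_sums:
  assumes "v \<in> verts G"
  shows "(\<lambda>j. (\<i> * of_real t) ^ j / fact j * of_int (krylov_vec j v)) sums transition G t v u"
proof -
  let ?M = "\<lambda>u v. \<i> * of_real t * of_real (weight G u v)"
  have "(\<lambda>j. matpow (verts G) ?M j v u / fact j) sums transition G t v u"
    unfolding transition_def matexp_def by (rule summable_sums[OF summable_matexp[OF finite_verts assms u]])
  then show ?thesis unfolding matpow_eq_krylov[OF assms] by simp
qed

text \<open>Each step of a walk changes sides, so the parity of its length decides on which side it
  ends.\<close>

lemma krylov_vec_parity:
  assumes XY: "X \<union> Y = verts G" "X \<inter> Y = {}" "edge_rel G \<subseteq> X \<times> Y \<union> Y \<times> X"
  shows "v \<in> verts G \<Longrightarrow> krylov_vec j v \<noteq> 0 \<Longrightarrow> (v \<in> X \<longleftrightarrow> u \<in> X) \<longleftrightarrow> even j"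
proof (induction j arbitrary: v)
  case 0
  then show ?case by (simp split: if_splits)
next
  case (Suc j)
  then obtain x where x: "x \<in> verts G" "A v x * krylov_vec j x \<noteq> 0"
    unfolding krylov_vec.simps by (meson sum.neutral)
  then have "(v, x) \<in> edge_rel G" unfolding edge_rel_iff by (metis mult_eq_0_iff of_int_A of_int_0_eq_iff)
  then have "v \<in> X \<longleftrightarrow> x \<notin> X" using XY by auto
  moreover have "(x \<in> X \<longleftrightarrow> u \<in> X) \<longleftrightarrow> even j" using Suc.IH x by simp
  ultimately show ?case by auto
qed

text \<open>Weights are nonnegative, so the walks counted by an entry cannot cancel and one path
  from \<open>u\<close> makes it nonzero.\<close>

lemma reachable:
  assumes "v \<in> verts G"
  shows "\<exists>j. krylov_vec j v \<noteq> 0"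
proof -
  have nn: "0 \<le> krylov_vec j v" for j v
    by (induction j arbitrary: v) (auto intro!: sum_nonneg mult_nonneg_nonneg A_nonneg)
  have "(u, v) \<in> (edge_rel G)\<^sup>*" using conn u assms unfolding connected_wgraph_def by blast
  then show ?thesis
  proof (induction rule: rtrancl_induct)
    case base
    show ?case by (intro exI[of _ 0]) simp
  next
    case (step y z)
    then obtain j where j: "krylov_vec j y \<noteq> 0" by blast
    have y: "y \<in> verts G" using step(2) by (simp add: edge_rel_def)
    have "A z y \<noteq> 0" using step(2) unfolding edge_rel_iff by (metis of_int_A A_sym of_int_0)
    then have "0 < A z y * krylov_vec j y" using j nn[of j y] A_nonneg[of z y] by (simp add: order_less_le)
    also have "\<dots> \<le> (\<Sum>x\<in>verts G. A z x * krylov_vec j x)"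
      using y finite_verts nn A_nonneg by (intro member_le_sum) auto
    finally have "krylov_vec (Suc j) z \<noteq> 0" by simp
    then show ?case ..
  qed
qed

lemma card_verts_le: "card (verts G) \<le> (2 * (k\<^sup>2 + 1)) * k ^ (2 * (k\<^sup>2 + 1))"
proof -
  obtain t where t: "t > 0" "\<And>v. v \<in> verts G \<Longrightarrow> cmod (transition G t v u) = 1 / sqrt (card (verts G))"
    using mix unfolding local_uniform_mixing_def by blast
  obtain X Y where XY: "X \<union> Y = verts G" "X \<inter> Y = {}" "edge_rel G \<subseteq> X \<times> Y \<union> Y \<times> X"
    using bip unfolding bipartite_wgraph_def by blast
  let ?n = "card (verts G)"
  let ?U = "\<lambda>v. transition G t v u"
  have n: "0 < ?n" using finite_verts u by (auto simp: card_gt_0_iff)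
  \<comment> \<open>On the side of \<open>u\<close> only even \<open>j\<close> contribute, for which
    the \<open>j\<close>-th power of \<open>\<i> * t\<close> is real. On the other side only odd
    \<open>j\<close> contribute, which gives \<open>re0\<close>.\<close>
  have im0: "Im (?U v) = 0" if v: "v \<in> verts G" "v \<in> X \<longleftrightarrow> u \<in> X" for v
  proof -
    have "Im ((\<i> * of_real t) ^ j / fact j * of_int (krylov_vec j v)) = 0" for j
    proof (cases "krylov_vec j v = 0")
      case False
      then have "even j" using krylov_vec_parity[OF XY v(1)] v(2) by blast
      then obtain m where j: "j = 2 * m" by blast
      have "\<i> ^ j = (- 1) ^ m" unfolding j by (simp add: power_mult)
      then have "(\<i> * of_real t) ^ j / fact j * of_int (krylov_vec j v)
          = of_real ((- 1) ^ m * t ^ j / fact j * of_int (krylov_vec j v))"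
        by (simp add: power_mult_distrib)
      then show ?thesis by (simp only: Im_complex_of_real)
    qed simp
    then show ?thesis using sums_Im[OF transition_sums[OF v(1), of t]] by (simp add: sums_0 sums_unique2)
  qed
  have re0: "Re (?U v) = 0" if v: "v \<in> verts G" "\<not> (v \<in> X \<longleftrightarrow> u \<in> X)" for v
  proof -
    have "Re ((\<i> * of_real t) ^ j / fact j * of_int (krylov_vec j v)) = 0" for j
    proof (cases "krylov_vec j v = 0")
      case False
      then have "odd j" using krylov_vec_parity[OF XY v(1)] v(2) by blast
      then obtain m where j: "j = 2 * m + 1" by (elim oddE)
      have "\<i> ^ j = \<i> * (- 1) ^ m" unfolding j by (simp add: power_mult)
      then have "(\<i> * of_real t) ^ j / fact j * of_int (krylov_vec j v)
          = \<i> * of_real ((- 1) ^ m * t ^ j / fact j * of_int (krylov_vec j v))"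
        by (simp add: power_mult_distrib)
      then show ?thesis by (simp only: Re_i_times Im_complex_of_real)
    qed simp
    then show ?thesis using sums_Re[OF transition_sums[OF v(1), of t]] by (simp add: sums_0 sums_unique2)
  qed
  \<comment> \<open>Mixing makes the relevant part nonzero, so the \<open>else\<close> branch of
    each sign test means a negative value.\<close>
  define s0 where "s0 v = (if v \<in> X \<longleftrightarrow> u \<in> X then if Re (?U v) > 0 then 1 else - 1 else 0 :: int)" for v
  define s1 where "s1 v = (if v \<in> X \<longleftrightarrow> u \<in> X then 0 else if Im (?U v) > 0 then 1 else - 1 :: int)" for v
  have s: "of_real (sqrt ?n) * ?U v = of_int (s0 v) + \<i> * of_int (s1 v)" if v: "v \<in> verts G" for v
  proof (cases "v \<in> X \<longleftrightarrow> u \<in> X")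
    case True
    have "\<bar>Re (?U v)\<bar> = 1 / sqrt ?n" using t(2)[OF v] im0[OF v True] by (simp add: cmod_def)
    then have "sqrt ?n * Re (?U v) = of_int (s0 v)" using n True by (auto simp: s0_def field_simps)
    then show ?thesis using True im0[OF v True] by (simp add: complex_eq_iff s1_def)
  next
    case False
    have "\<bar>Im (?U v)\<bar> = 1 / sqrt ?n" using t(2)[OF v] re0[OF v False] by (simp add: cmod_def)
    then have "sqrt ?n * Im (?U v) = of_int (s1 v)" using n False by (auto simp: s1_def field_simps)
    then show ?thesis using False re0[OF v False] by (simp add: complex_eq_iff s0_def)
  qed
  have k': "(\<Sum>x\<in>verts G. \<bar>real_of_int (A v x)\<bar>) \<le> real k" if "v \<in> verts G" for v
    using sum_weight_le[OF that] A_nonneg by (simp flip: of_int_A)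
  have "mdeg \<le> 2 * (k\<^sup>2 + 1)"
    by (rule minpol_degree_le_if_quantized[OF n _ transition_sums s k']) (use t in auto)
  moreover have "(\<Sum>x\<in>verts G. A v x) \<le> int k" if "v \<in> verts G" for v
  proof -
    have "real_of_int (\<Sum>x\<in>verts G. A v x) \<le> real_of_int (int k)"
      using sum_weight_le[OF that] by (simp add: of_int_A)
    then show ?thesis by (simp only: of_int_le_iff)
  qed
  ultimately show ?thesis using card_le_if_reachable[OF A_nonneg _ reachable _ k1] by blast
qed

lemma weight_nat_le:
  assumes "x \<in> verts G" "y \<in> verts G"
  shows "nat \<lfloor>weight G x y\<rfloor> \<le> k" "real (nat \<lfloor>weight G x y\<rfloor>) = weight G x y"
proof -
  have "weight G x y \<le> (\<Sum>y\<in>verts G. weight G x y)"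
    using assms finite_verts G by (intro member_le_sum) (auto simp: wgraph_def)
  then have "weight G x y \<le> real k" using sum_weight_le[OF assms(1)] by simp
  moreover show e: "real (nat \<lfloor>weight G x y\<rfloor>) = weight G x y"
    using of_int_A[of x y] A_nonneg[of x y] unfolding A_def by simp
  ultimately show "nat \<lfloor>weight G x y\<rfloor> \<le> k" by (metis of_nat_le_iff)
qed

end

section \<open>From bounded size and weights to finitely many isomorphism classes\<close>

lemma finite_iso_classes:
  fixes S :: "'a wgraph set" and N k :: nat
  assumes wg: "\<And>G. G \<in> S \<Longrightarrow> wgraph G" and N: "\<And>G. G \<in> S \<Longrightarrow> card (verts G) \<le> N"
    and k: "\<And>G x y. G \<in> S \<Longrightarrow> x \<in> verts G \<Longrightarrow> y \<in> verts G \<Longrightarrow>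
      nat \<lfloor>weight G x y\<rfloor> \<le> k \<and> real (nat \<lfloor>weight G x y\<rfloor>) = weight G x y"
  shows "finite (S // wgraph_iso_rel)"
proof -
  have "\<exists>b. bij_betw b {0..<card (verts G)} (verts G)" if "G \<in> S" for G
    using wg[OF that] ex_bij_betw_nat_finite unfolding wgraph_def by blast
  then obtain b where b: "\<And>G. G \<in> S \<Longrightarrow> bij_betw (b G) {0..<card (verts G)} (verts G)" by metis
  \<comment> \<open>A numbered weight table, padded with 0 to the fixed size \<open>N\<close> by
    \<open>N\<close>, so that the codes of graphs of different sizes lie in one finite set. The
    vertex count is kept to tell padding from isolated positions; equal codes yield an isomorphism
    by matching the numberings.\<close>
  define code where "code G = (card (verts G), restrict (\<lambda>(i, j).
     if i < card (verts G) \<and> j < card (verts G) then nat \<lfloor>weight G (b G i) (b G j)\<rfloor> else 0) ({..<N} \<times> {..<N}))" for G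
  have "code ` S \<subseteq> {..N} \<times> PiE ({..<N} \<times> {..<N}) (\<lambda>_. {..k})"
  proof (rule image_subsetI)
    fix G assume G: "G \<in> S"
    have "b G i \<in> verts G" if "i < card (verts G)" for i using bij_betwE[OF b[OF G]] that by simp
    then show "code G \<in> {..N} \<times> PiE ({..<N} \<times> {..<N}) (\<lambda>_. {..k})"
      unfolding code_def using N[OF G] k[OF G] by auto
  qed
  then have fin: "finite (code ` S)" by (rule finite_subset) (intro finite_SigmaI finite_PiE; simp)
  have iso: "(G, H) \<in> wgraph_iso_rel" if GH: "G \<in> S" "H \<in> S" and c: "code G = code H" for G H
  proof -
    let ?n = "card (verts G)"
    have n: "card (verts H) = ?n" using c unfolding code_def by simp
    let ?i = "inv_into {0..<?n} (b G)"
    have bi: "bij_betw ?i (verts G) {0..<?n}" using b[OF GH(1)] by (rule bij_betw_inv_into)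
    have bH: "bij_betw (b H) {0..<?n} (verts H)" using b[OF GH(2)] n by simp
    have w: "weight H ((b H \<circ> ?i) x) ((b H \<circ> ?i) y) = weight G x y" if xy: "x \<in> verts G" "y \<in> verts G" for x y
    proof -
      have lt: "?i x < ?n" "?i y < ?n" using bij_betwE[OF bi] xy by auto
      have bb: "b G (?i x) = x" "b G (?i y) = y" using bij_betw_inv_into_right[OF b[OF GH(1)]] xy by auto
      have vH: "b H (?i x) \<in> verts H" "b H (?i y) \<in> verts H" using bij_betwE[OF bH] lt by auto
      have "snd (code G) (?i x, ?i y) = snd (code H) (?i x, ?i y)" using c by simp
      then have "nat \<lfloor>weight G x y\<rfloor> = nat \<lfloor>weight H (b H (?i x)) (b H (?i y))\<rfloor>"
        unfolding code_def using lt n N[OF GH(1)] bb by simp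
      then show ?thesis using k[OF GH(1) xy] k[OF GH(2) vH] by (metis comp_apply)
    qed
    have "bij_betw (b H \<circ> ?i) (verts G) (verts H)" using bij_betw_trans[OF bi bH] .
    with w show ?thesis using wg GH unfolding wgraph_iso_rel_def isomorphic_wgraph_def by blast
  qed
  define g where "g c = wgraph_iso_rel `` {SOME H. H \<in> S \<and> code H = c}" for c
  have "S // wgraph_iso_rel \<subseteq> g ` (code ` S)"
  proof
    fix C assume "C \<in> S // wgraph_iso_rel"
    then obtain G where G: "G \<in> S" "C = wgraph_iso_rel `` {G}" by (auto elim: quotientE)
    define H where "H = (SOME H. H \<in> S \<and> code H = code G)"
    have H: "H \<in> S" "code H = code G" using someI[of "\<lambda>H. H \<in> S \<and> code H = code G" G] G unfolding H_def by auto
    have "C = g (code G)" unfolding G(2) g_def H_def[symmetric]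
      using equiv_class_eq[OF equiv_wgraph_iso_rel iso[OF H(1) G(1) H(2)]] by simp
    then show "C \<in> g ` (code ` S)" using G(1) by blast
  qed
  then show ?thesis using fin finite_surj by blast
qed

theorem theorem8:
  fixes k :: int
  assumes "k > 0"
  shows "finite ({G :: 'a wgraph. wgraph G \<and> connected_wgraph G \<and> integer_weighted G
           \<and> bipartite_wgraph G \<and> max_degree G \<le> of_int k
           \<and> (\<exists>u\<in>verts G. local_uniform_mixing G u)} // wgraph_iso_rel)"
proof -
  define m where "m = nat k"
  have km: "of_int k = real m" "1 \<le> m" unfolding m_def using assms by auto
  let ?S = "{G :: 'a wgraph. wgraph G \<and> connected_wgraph G \<and> integer_weighted G
           \<and> bipartite_wgraph G \<and> max_degree G \<le> of_int k
           \<and> (\<exists>u\<in>verts G. local_uniform_mixing G u)}"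
  have mg: "\<exists>u. mixing_graph G u m" if "G \<in> ?S" for G
    using that km unfolding mixing_graph_def by auto
  show ?thesis
  proof (rule finite_iso_classes[where N = "(2 * (m\<^sup>2 + 1)) * m ^ (2 * (m\<^sup>2 + 1))" and k = m])
    fix G assume G: "G \<in> ?S"
    then obtain u where "mixing_graph G u m" using mg by blast
    then interpret mixing_graph G u m .
    show "wgraph G" using G by simp
    show "card (verts G) \<le> (2 * (m\<^sup>2 + 1)) * m ^ (2 * (m\<^sup>2 + 1))" by (rule card_verts_le)
    show "nat \<lfloor>weight G x y\<rfloor> \<le> m \<and> real (nat \<lfloor>weight G x y\<rfloor>) = weight G x y"
      if "x \<in> verts G" "y \<in> verts G" for x y
      using weight_nat_le[OF that] by blast
  qed
qed

end
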